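(* There is a bottom-up dynamic programming algorithm (\textsc{algorithm Parts}) on the uniform-cost RAM which, given any instance of the optimum-BST-on-the-HMM problem with $n$ keys and a memory hierarchy with $h\le n$ levels of sizes $m_1,\dots,m_h$, constructs an optimum solution $\langle T^*,\phi^*\rangle$ in time $$O\!\left(\frac{2^{h-1}}{(h-1)!}\cdot n^{2h+1}\right).$$
   Context: Binary search trees. Given $n\ge 1$ keys $x_1\prec x_2\prec\cdots\prec x_n$ from a totally ordered universe, a binary search tree (BST) $T$ over the keys is an ordered rooted binary tree with $n$ internal nodes, identified with the keys so that an inorder traversal visits $x_1,\dots,x_n$ in order, and $n+1$ external nodes (leaves) $z_0,\dots,z_n$ from left to right, where $z_j$ represents the search arguments $y$ with $x_j\prec y\prec x_{j+1}$ (with the convention that $z_0$ means $y\prec x_1$ and $z_n$ means $y\succ x_n$). Also given are $p_i\ge 0$ ($1\le i\le n$), the probability that $y=x_i$, and $q_j\ge 0$ ($0\le j\le n$), the probability that $y$ falls in the interval of $z_j$; $\sum_i p_i+\sum_j q_j=1$. For a node $v$ of $T$, let $T_v$ be the subtree rooted at $v$ and let $w(T_v)$ be the sum of all $p_i$ and $q_j$ over the internal nodes $x_i$ and external nodes $z_j$ in $T_v$; in particular $w(T_{z_j})=q_j$. Hierarchical memory (HMM). There are $n$ memory locations with addresses $1,\dots,n$ partitioned into $h$ levels, level $l$ having $m_l$ locations, $\sum_{l=1}^h m_l=n$. A single access to a location in level $l$ costs $c_l\in\mathbb N$, where $c_1<c_2<\cdots<c_h$. The addresses are ordered from fastest to slowest,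 so $\mu(a)=c_l$ when $m_1+\cdots+m_{l-1}<a\le m_1+\cdots+m_l$. The problem. A solution is a pair $\langle T,\phi\rangle$ of a BST $T$ over the keys and a one-to-one memory assignment $\phi$ of the internal nodes of $T$ to the addresses $\{1,\dots,n\}$. External nodes are not stored; for an external node $z_j$, $\phi(z_j)$ denotes the address at which the parent of $z_j$ is stored. The cost of a solution (called the expected cost of a search) is $$\mathrm{cost}(\langle T,\phi\rangle)=\sum_{i=1}^n w(T_{x_i})\,\mu(\phi(x_i))+\sum_{j=0}^n w(T_{z_j})\,\mu(\phi(z_j)).$$ A solution is optimum if its cost is minimum over all pairs $\langle T,\phi\rangle$. The algorithm is given the $p_i$, $q_j$, $m_l$ and $c_l$. Uniform-cost RAM: each memory access, arithmetic operation and comparison on numbers takes unit time. *)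

theory Defs
  imports Complex_Main "HOL-Library.FuncSet"
begin

section \<open>Binary search trees with explicit external nodes\<close>

text \<open>
  The keys enter the problem only through their order, and they are not part of the input of
  the algorithm; the key \<open>x\<^sub>i\<close> is therefore represented by its rank \<open>i \<in> {1..n}\<close>.
  The label of an external node \<open>z\<^sub>j\<close> is \<open>j \<in> {0..n}\<close>.
\<close>

datatype bst = Ext nat | Node bst nat bst

datatype node = Key nat | Gap nat

fun int_labels :: "bst \<Rightarrow> nat list" where
  "int_labels (Ext j) = []"
| "int_labels (Node l k r) = int_labels l @ [k] @ int_labels r"

fun ext_labels :: "bst \<Rightarrow> nat list" where
  "ext_labels (Ext j) = [j]"
| "ext_labels (Node l k r) = ext_labels l @ ext_labels r"

definition is_bst :: "nat \<Rightarrow> bst \<Rightarrow> bool" where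
  "is_bst n T \<longleftrightarrow> int_labels T = [1..<n+1] \<and> ext_labels T = [0..<n+1]"

definition nodes :: "bst \<Rightarrow> node set" where
  "nodes T = Key ` set (int_labels T) \<union> Gap ` set (ext_labels T)"

text \<open>\<open>subtree T v\<close> is \<open>T\<^sub>v\<close>; it is meaningful when \<open>v\<close> is a node of \<open>T\<close> and labels are distinct.\<close>

fun subtree :: "bst \<Rightarrow> node \<Rightarrow> bst" where
  "subtree (Ext j) v = Ext j"
| "subtree (Node l k r) v =
     (if v = Key k then Node l k r
      else if v \<in> nodes l then subtree l v
      else subtree r v)"

text \<open>The label of the (internal) parent of the external node \<open>z\<^sub>j\<close>.\<close>

fun ext_parent :: "bst \<Rightarrow> nat \<Rightarrow> nat" where
  "ext_parent (Ext i) j = undefined"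
| "ext_parent (Node l k r) j =
     (if l = Ext j \<or> r = Ext j then k
      else if Gap j \<in> nodes l then ext_parent l j
      else ext_parent r j)"

definition weight :: "(nat \<Rightarrow> real) \<Rightarrow> (nat \<Rightarrow> real) \<Rightarrow> bst \<Rightarrow> real" where
  "weight p q T = (\<Sum>i\<in>set (int_labels T). p i) + (\<Sum>j\<in>set (ext_labels T). q j)"


section \<open>The optimum BST problem on the hierarchical memory model\<close>

text \<open>
  \<open>lsize l\<close> and \<open>lcost l\<close> are relevant for \<open>1 \<le> l \<le> nlevels\<close>, \<open>prob_key i\<close> for \<open>1 \<le> i \<le> nkeys\<close> and
  \<open>prob_gap j\<close> for \<open>0 \<le> j \<le> nkeys\<close>.
\<close>

record hmm_problem =
  nkeys :: nat
  nlevels :: nat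
  lsize :: "nat \<Rightarrow> nat"
  lcost :: "nat \<Rightarrow> nat"
  prob_key :: "nat \<Rightarrow> real"
  prob_gap :: "nat \<Rightarrow> real"

definition valid_problem :: "hmm_problem \<Rightarrow> bool" where
  "valid_problem I \<longleftrightarrow>
     1 \<le> nkeys I \<and> 1 \<le> nlevels I \<and> nlevels I \<le> nkeys I \<and>
     (\<Sum>l=1..nlevels I. lsize I l) = nkeys I \<and>
     strict_mono_on {1..nlevels I} (lcost I) \<and>
     (\<forall>i\<in>{1..nkeys I}. 0 \<le> prob_key I i) \<and>
     (\<forall>j\<in>{0..nkeys I}. 0 \<le> prob_gap I j) \<and>
     (\<Sum>i=1..nkeys I. prob_key I i) + (\<Sum>j=0..nkeys I. prob_gap I j) = 1"

definition access_cost :: "hmm_problem \<Rightarrow> nat \<Rightarrow> nat" where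
  "access_cost I a =
     lcost I (THE l. l \<in> {1..nlevels I} \<and>
                     (\<Sum>k=1..<l. lsize I k) < a \<and> a \<le> (\<Sum>k=1..l. lsize I k))"

definition is_solution :: "hmm_problem \<Rightarrow> bst \<Rightarrow> (nat \<Rightarrow> nat) \<Rightarrow> bool" where
  "is_solution I T \<phi> \<longleftrightarrow>
     is_bst (nkeys I) T \<and> \<phi> \<in> {1..nkeys I} \<rightarrow> {1..nkeys I} \<and> inj_on \<phi> {1..nkeys I}"

fun node_addr :: "bst \<Rightarrow> (nat \<Rightarrow> nat) \<Rightarrow> node \<Rightarrow> nat" where
  "node_addr T \<phi> (Key i) = \<phi> i"
| "node_addr T \<phi> (Gap j) = \<phi> (ext_parent T j)"

definition cost :: "hmm_problem \<Rightarrow> bst \<Rightarrow> (nat \<Rightarrow> nat) \<Rightarrow> real" where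
  "cost I T \<phi> =
     (let w = (\<lambda>v. weight (prob_key I) (prob_gap I) (subtree T v));
          \<mu> = (\<lambda>v. real (access_cost I (node_addr T \<phi> v)))
      in (\<Sum>i=1..nkeys I. w (Key i) * \<mu> (Key i)) + (\<Sum>j=0..nkeys I. w (Gap j) * \<mu> (Gap j)))"

definition optimum :: "hmm_problem \<Rightarrow> bst \<Rightarrow> (nat \<Rightarrow> nat) \<Rightarrow> bool" where
  "optimum I T \<phi> \<longleftrightarrow>
     is_solution I T \<phi> \<and> (\<forall>T' \<phi>'. is_solution I T' \<phi>' \<longrightarrow> cost I T \<phi> \<le> cost I T' \<phi>')"


section \<open>Uniform-cost random access machine\<close>

text \<open>
  The probabilities are real numbers while addresses, sizes and access costs are natural numbers,
  so the machine has two kinds of cells, as is customary for the real RAM: registers and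
  random-access memory for naturals (\<open>nreg\<close>, \<open>nmem\<close>) and for reals (\<open>rreg\<close>, \<open>rmem\<close>). Memory is
  addressed through natural registers only, and there is no conversion from reals to naturals
  (rounding a real at unit cost would make the machine unreasonably powerful). Natural subtraction
  and division are the ones of type \<^typ>\<open>nat\<close>; division by zero yields zero.

  In each instruction the first register is the destination, except that in \<open>NStore a b\<close> and
  \<open>RStore a b\<close> the memory address is the content of the natural register \<open>a\<close>. Jump targets are
  absolute. The machine halts by leaving the program text.
\<close>

datatype arith_op = Plus | Minus | Times | Divide

fun nat_op :: "arith_op \<Rightarrow> nat \<Rightarrow> nat \<Rightarrow> nat" where
  "nat_op Plus x y = x + y"
| "nat_op Minus x y = x - y"
| "nat_op Times x y = x * y"
| "nat_op Divide x y = x div y"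

fun real_op :: "arith_op \<Rightarrow> real \<Rightarrow> real \<Rightarrow> real" where
  "real_op Plus x y = x + y"
| "real_op Minus x y = x - y"
| "real_op Times x y = x * y"
| "real_op Divide x y = x / y"

datatype instr =
    NConst nat nat
  | NArith arith_op nat nat nat
  | NLoad nat nat
  | NStore nat nat
  | RofN nat nat
  | RArith arith_op nat nat nat
  | RLoad nat nat
  | RStore nat nat
  | Jump nat
  | NJumpLe nat nat nat
  | RJumpLe nat nat nat

record ram_state =
  pc :: nat
  nreg :: "nat \<Rightarrow> nat"
  rreg :: "nat \<Rightarrow> real"
  nmem :: "nat \<Rightarrow> nat"
  rmem :: "nat \<Rightarrow> real"

fun exec_instr :: "instr \<Rightarrow> ram_state \<Rightarrow> ram_state" where
  "exec_instr (NConst a x) s = s\<lparr>pc := pc s + 1, nreg := (nreg s)(a := x)\<rparr>"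
| "exec_instr (NArith f a b c) s =
     s\<lparr>pc := pc s + 1, nreg := (nreg s)(a := nat_op f (nreg s b) (nreg s c))\<rparr>"
| "exec_instr (NLoad a b) s = s\<lparr>pc := pc s + 1, nreg := (nreg s)(a := nmem s (nreg s b))\<rparr>"
| "exec_instr (NStore a b) s = s\<lparr>pc := pc s + 1, nmem := (nmem s)(nreg s a := nreg s b)\<rparr>"
| "exec_instr (RofN a b) s = s\<lparr>pc := pc s + 1, rreg := (rreg s)(a := real (nreg s b))\<rparr>"
| "exec_instr (RArith f a b c) s =
     s\<lparr>pc := pc s + 1, rreg := (rreg s)(a := real_op f (rreg s b) (rreg s c))\<rparr>"
| "exec_instr (RLoad a b) s = s\<lparr>pc := pc s + 1, rreg := (rreg s)(a := rmem s (nreg s b))\<rparr>"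
| "exec_instr (RStore a b) s = s\<lparr>pc := pc s + 1, rmem := (rmem s)(nreg s a := rreg s b)\<rparr>"
| "exec_instr (Jump i) s = s\<lparr>pc := i\<rparr>"
| "exec_instr (NJumpLe a b i) s = s\<lparr>pc := (if nreg s a \<le> nreg s b then i else pc s + 1)\<rparr>"
| "exec_instr (RJumpLe a b i) s = s\<lparr>pc := (if rreg s a \<le> rreg s b then i else pc s + 1)\<rparr>"

definition halted :: "instr list \<Rightarrow> ram_state \<Rightarrow> bool" where
  "halted P s \<longleftrightarrow> length P \<le> pc s"

definition step :: "instr list \<Rightarrow> ram_state \<Rightarrow> ram_state" where
  "step P s = (if halted P s then s else exec_instr (P ! pc s) s)"

text \<open>
  Every instruction takes one time unit; \<open>halts_within P t s s'\<close> says that \<open>P\<close> started in \<open>s\<close> halts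
  in the final state \<open>s'\<close> after at most \<open>t\<close> time units.
\<close>

definition halts_within :: "instr list \<Rightarrow> nat \<Rightarrow> ram_state \<Rightarrow> ram_state \<Rightarrow> bool" where
  "halts_within P t s s' \<longleftrightarrow> (step P ^^ t) s = s' \<and> halted P s'"


section \<open>Input and output conventions\<close>

text \<open>
  Input: natural memory holds \<open>n, h, m\<^sub>1, \<dots>, m\<^sub>h, c\<^sub>1, \<dots>, c\<^sub>h\<close> from address 0 on, real memory holds
  \<open>p\<^sub>1, \<dots>, p\<^sub>n, q\<^sub>0, \<dots>, q\<^sub>n\<close> from address 1 on; everything else is zero.
\<close>

definition input_state :: "hmm_problem \<Rightarrow> ram_state" where
  "input_state I =
     (let n = nkeys I; h = nlevels I in
      \<lparr> pc = 0,
        nreg = (\<lambda>_. 0),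
        rreg = (\<lambda>_. 0),
        nmem = (\<lambda>a. if a = 0 then n
                    else if a = 1 then h
                    else if a \<le> h + 1 then lsize I (a - 1)
                    else if a \<le> 2 * h + 1 then lcost I (a - (h + 1))
                    else 0),
        rmem = (\<lambda>a. if a = 0 then 0
                    else if a \<le> n then prob_key I a
                    else if a \<le> 2 * n + 1 then prob_gap I (a - (n + 1))
                    else 0) \<rparr>)"

text \<open>
  Output, in natural memory: cell 0 holds the root, and cells \<open>3i\<close>, \<open>3i+1\<close>, \<open>3i+2\<close> hold the left
  child of \<open>x\<^sub>i\<close>, its right child, and the address \<open>\<phi>(x\<^sub>i)\<close>. The key \<open>x\<^sub>i\<close> is denoted by \<open>i\<close> and every
  external node by 0.
\<close>

fun stores_tree :: "(nat \<Rightarrow> nat) \<Rightarrow> nat \<Rightarrow> bst \<Rightarrow> bool" where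
  "stores_tree M v (Ext j) \<longleftrightarrow> v = 0"
| "stores_tree M v (Node l k r) \<longleftrightarrow>
     v = k \<and> stores_tree M (M (3 * k)) l \<and> stores_tree M (M (3 * k + 1)) r"

definition outputs :: "nat \<Rightarrow> ram_state \<Rightarrow> bst \<Rightarrow> (nat \<Rightarrow> nat) \<Rightarrow> bool" where
  "outputs n s T \<phi> \<longleftrightarrow>
     stores_tree (nmem s) (nmem s 0) T \<and> (\<forall>i\<in>{1..n}. nmem s (3 * i + 2) = \<phi> i)"

end

theory Submission
  imports Defs
begin

text \<open>
  A choice of \<open>u\<^sub>l \<le> m\<^sub>l\<close> addresses from every level \<open>l\<close> is encoded by the mixed radix number
  \<open>c = \<Sum> u\<^sub>l B\<^sub>l\<close> with \<open>B\<^sub>l = \<Prod>\<^bsub>k<l\<^esub> (m\<^sub>k + 1)\<close>; so \<open>c < N = \<Prod> (m\<^sub>l + 1)\<close>, and the digit sum \<open>S c\<close>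
  is the number of keys to be stored. A subproblem is a pair \<open>(c, i)\<close>: the optimum tree for the keys
  \<open>x\<^bsub>i+1\<^esub>, \<dots>, x\<^bsub>i+S c\<^esub>\<close>. Putting the root on level \<open>l\<close> and giving the code \<open>a\<close> to the left subtree
  leaves \<open>b = c - a - B\<^sub>l\<close> for the right one, and the root is \<open>x\<^bsub>i+S a+1\<^esub>\<close>.
  The only test needed is \<open>S a + S b + 1 = S c\<close>: the digits form the unique shortest representation of
  a number by the \<open>B\<^sub>l\<close> with \<open>m\<^sub>l > 0\<close>, hence \<open>n\<close> levels whose \<open>B\<close>-values add up to \<open>N - 1\<close> contain
  every level \<open>l\<close> exactly \<open>m\<^sub>l\<close> times.

  Trying all \<open>(l, a)\<close> for all \<open>(c, i)\<close> takes \<open>O(N\<^sup>2 h n)\<close> steps. By the inequality of arithmetic and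
  geometric means \<open>N \<le> (2 n / h)\<^sup>h\<close>, and \<open>h\<^bsup>2 h\<^esup>\<close> in the denominator outweighs
  \<open>4\<^sup>h h (h-1)! / 2\<^bsup>h-1\<^esup>\<close>.
\<close>

section \<open>Structured programs and their compilation\<close>

text \<open>The cost depends on \<phi> only through the level of each key, because the addresses of
  one level are interchangeable. This is what reduces memory assignments to level functions, and the
  capacities still available to a code. The obstacle is the carry: a root on level \<open>l\<close>
  and the codes \<open>a\<close> and \<open>b\<close> may add up to \<open>c\<close> although their
  digits do not. A carry out of a level of positive size replaces \<open>m l + 1\<close> units by
  one and so lowers the digit sum; comparing digit sums therefore detects it without a look at
  single digits. For constructed trees this is exploited only once, at the full code. A level of
  size 0 escapes the argument, since its place value equals that of the next level, and is excluded
  by hand. Leaves are charged at the address of their parent, so a root has to know which of its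
  children are leaves; a code equal to 0 tells. The machine has no procedures. The tree is written
  by a loop over an explicit stack, whose correctness needs an induction on subproblems rather than
  on iterations; this is why the sequencing rules put the rest of the run into the
  postcondition.\<close>

datatype com =
    Blk "instr list"
  | Seq com com (infixr ";;" 60)
  | If nat nat com com
  | IfR nat nat com com
  | While nat nat com

fun clen :: "com \<Rightarrow> nat" where
  "clen (Blk ins) = length ins"
| "clen (c ;; d) = clen c + clen d"
| "clen (If a b c d) = clen c + clen d + 2"
| "clen (IfR a b c d) = clen c + clen d + 2"
| "clen (While a b c) = clen c + 2"

text \<open>The available tests are on \<le>. A successful test jumps to the first branch, so the
  second branch is laid out directly behind the test; a loop is left when \<open>b\<close> is at
  most \<open>a\<close>, hence it runs while register \<open>a\<close> is smaller than register
  \<open>b\<close>.\<close>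

fun comp :: "nat \<Rightarrow> com \<Rightarrow> instr list" where
  "comp k (Blk ins) = ins"
| "comp k (c ;; d) = comp k c @ comp (k + clen c) d"
| "comp k (If a b c d) =
     [NJumpLe a b (k + clen d + 2)] @ comp (k + 1) d @
     [Jump (k + clen d + 2 + clen c)] @ comp (k + clen d + 2) c"
| "comp k (IfR a b c d) =
     [RJumpLe a b (k + clen d + 2)] @ comp (k + 1) d @
     [Jump (k + clen d + 2 + clen c)] @ comp (k + clen d + 2) c"
| "comp k (While a b c) = [NJumpLe b a (k + clen c + 2)] @ comp (k + 1) c @ [Jump k]"

lemma length_comp [simp]: "length (comp k c) = clen c"
  by (induction c arbitrary: k) auto

text \<open>\<open>exec_instr\<close> freed from the program counter, so that a block of straight
  code is a plain \<open>fold\<close> which simplification can evaluate.\<close>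

fun effect :: "instr \<Rightarrow> ram_state \<Rightarrow> ram_state" where
  "effect (NConst a x) s = s\<lparr>nreg := (nreg s)(a := x)\<rparr>"
| "effect (NArith f a b c) s = s\<lparr>nreg := (nreg s)(a := nat_op f (nreg s b) (nreg s c))\<rparr>"
| "effect (NLoad a b) s = s\<lparr>nreg := (nreg s)(a := nmem s (nreg s b))\<rparr>"
| "effect (NStore a b) s = s\<lparr>nmem := (nmem s)(nreg s a := nreg s b)\<rparr>"
| "effect (RofN a b) s = s\<lparr>rreg := (rreg s)(a := real (nreg s b))\<rparr>"
| "effect (RArith f a b c) s = s\<lparr>rreg := (rreg s)(a := real_op f (rreg s b) (rreg s c))\<rparr>"
| "effect (RLoad a b) s = s\<lparr>rreg := (rreg s)(a := rmem s (nreg s b))\<rparr>"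
| "effect (RStore a b) s = s\<lparr>rmem := (rmem s)(nreg s a := rreg s b)\<rparr>"
| "effect _ s = s"

fun straight :: "instr \<Rightarrow> bool" where
  "straight (Jump _) = False"
| "straight (NJumpLe _ _ _) = False"
| "straight (RJumpLe _ _ _) = False"
| "straight _ = True"

lemma exec_straight: "straight x \<Longrightarrow> exec_instr x (s\<lparr>pc := k\<rparr>) = (effect x s)\<lparr>pc := k + 1\<rparr>"
  by (cases x) auto

text \<open>A total-correctness triple with a time bound. Quantifying over the surrounding text
  \<open>xs\<close> and \<open>ys\<close> makes fragments composable at any position. The counter is
  overwritten on both sides, so the state handed to \<open>Q\<close> has an unspecified
  counter.\<close>

definition runs :: "com \<Rightarrow> ram_state \<Rightarrow> nat \<Rightarrow> (ram_state \<Rightarrow> bool) \<Rightarrow> bool" where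
  "runs c s t Q \<longleftrightarrow> (\<forall>xs ys. \<exists>t' s'. t' \<le> t \<and>
     (step (xs @ comp (length xs) c @ ys) ^^ t') (s\<lparr>pc := length xs\<rparr>)
       = s'\<lparr>pc := length xs + clen c\<rparr> \<and> Q s')"

lemma runsD:
  assumes "runs c s t Q" "P = xs @ comp k c @ ys" "k = length xs"
  obtains t' s' where "t' \<le> t" "(step P ^^ t') (s\<lparr>pc := k\<rparr>) = s'\<lparr>pc := k + clen c\<rparr>" "Q s'"
  using assms unfolding runs_def by blast

lemma runsI:
  assumes "\<And>P xs k ys. P = xs @ comp k c @ ys \<Longrightarrow> k = length xs \<Longrightarrow>
     \<exists>t' s'. t' \<le> t \<and> (step P ^^ t') (s\<lparr>pc := k\<rparr>) = s'\<lparr>pc := k + clen c\<rparr> \<and> Q s'"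
  shows "runs c s t Q"
  using assms unfolding runs_def by blast

lemma runs_conseq: "runs c s t Q \<Longrightarrow> t \<le> t' \<Longrightarrow> (\<And>s. Q s \<Longrightarrow> Q' s) \<Longrightarrow> runs c s t' Q'"
  unfolding runs_def by (meson order_trans)

lemma step_trans:
  "(step P ^^ t) s = s' \<Longrightarrow> (step P ^^ t') s' = s'' \<Longrightarrow> (step P ^^ (t + t')) s = s''"
  by (metis add.commute comp_apply funpow_add)

lemma step_nth:
  "P = xs @ x # ys \<Longrightarrow> k = length xs \<Longrightarrow> step P (s\<lparr>pc := k\<rparr>) = exec_instr x (s\<lparr>pc := k\<rparr>)"
  by (simp add: step_def halted_def nth_append)

lemma run_straight:
  "list_all straight ins \<Longrightarrow> P = xs @ ins @ ys \<Longrightarrow> k = length xs \<Longrightarrow>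
   (step P ^^ length ins) (s\<lparr>pc := k\<rparr>) = (fold effect ins s)\<lparr>pc := k + length ins\<rparr>"
proof (induction ins arbitrary: s xs k)
  case (Cons x ins)
  have "step P (s\<lparr>pc := k\<rparr>) = (effect x s)\<lparr>pc := k + 1\<rparr>"
    using Cons.prems step_nth[of P xs x "ins @ ys" k s] by (simp add: exec_straight)
  moreover have "(step P ^^ length ins) ((effect x s)\<lparr>pc := k + 1\<rparr>)
      = (fold effect ins (effect x s))\<lparr>pc := k + 1 + length ins\<rparr>"
    using Cons.prems by (intro Cons.IH[of "xs @ [x]"]) auto
  ultimately show ?case
    by (simp add: funpow_swap1)
qed auto

lemma runs_Blk:
  "list_all straight ins \<Longrightarrow> length ins \<le> t \<Longrightarrow> Q (fold effect ins s) \<Longrightarrow> runs (Blk ins) s t Q"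
  by (rule runsI) (use run_straight in fastforce)

lemma runs_Seq:
  assumes "runs c s t1 (\<lambda>s'. runs d s' t2 Q)" "t1 + t2 \<le> t"
  shows "runs (c ;; d) s t Q"
proof (rule runsI)
  fix P xs k ys assume P: "P = xs @ comp k (c ;; d) @ ys" and k: "k = length xs"
  obtain u s' where u: "u \<le> t1" "(step P ^^ u) (s\<lparr>pc := k\<rparr>) = s'\<lparr>pc := k + clen c\<rparr>" "runs d s' t2 Q"
    using runsD[OF assms(1), of P xs k "comp (k + clen c) d @ ys"] P k by auto
  obtain v s'' where v: "v \<le> t2"
    "(step P ^^ v) (s'\<lparr>pc := k + clen c\<rparr>) = s''\<lparr>pc := k + clen c + clen d\<rparr>" "Q s''"
    using runsD[OF u(3), of P "xs @ comp k c" "k + clen c" ys] P k by auto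
  show "\<exists>t' s'. t' \<le> t \<and> (step P ^^ t') (s\<lparr>pc := k\<rparr>) = s'\<lparr>pc := k + clen (c ;; d)\<rparr> \<and> Q s'"
    using step_trans[OF u(2) v(2)] u(1) v(1,3) assms(2)
    by (intro exI[of _ "u + v"] exI[of _ s'']) (auto simp: add.assoc)
qed

text \<open>One argument for natural and real comparisons, with the test abstracted to
  \<open>B\<close>. The two extra units pay for the test and for the jump over the other
  branch.\<close>

lemma branch_run:
  assumes P: "P = xs @ ([x] @ comp (k + 1) d @ [Jump (k + clen d + 2 + clen c)] @
                comp (k + clen d + 2) c) @ ys"
    and k: "k = length xs"
    and x: "\<And>s. exec_instr x (s\<lparr>pc := k\<rparr>) = s\<lparr>pc := if B s then k + clen d + 2 else k + 1\<rparr>"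
    and c: "B s \<Longrightarrow> runs c s t Q" and d: "\<not> B s \<Longrightarrow> runs d s t Q" and t: "t + 2 \<le> t'"
  shows "\<exists>u s'. u \<le> t' \<and> (step P ^^ u) (s\<lparr>pc := k\<rparr>) = s'\<lparr>pc := k + (clen c + clen d + 2)\<rparr> \<and> Q s'"
proof (cases "B s")
  case True
  have 1: "(step P ^^ 1) (s\<lparr>pc := k\<rparr>) = s\<lparr>pc := k + clen d + 2\<rparr>"
    using step_nth[of P xs x _ k s] P k x True by simp
  obtain v s'' where v: "v \<le> t"
    "(step P ^^ v) (s\<lparr>pc := k + clen d + 2\<rparr>) = s''\<lparr>pc := k + clen d + 2 + clen c\<rparr>" "Q s''"
    using runsD[OF c[OF True], of P
        "xs @ [x] @ comp (k + 1) d @ [Jump (k + clen d + 2 + clen c)]" "k + clen d + 2" ys] P k by auto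
  show ?thesis
    using step_trans[OF 1 v(2)] v(1,3) t
    by (intro exI[of _ "1 + v"] exI[of _ s'']) (auto simp: algebra_simps)
next
  case False
  have 1: "(step P ^^ 1) (s\<lparr>pc := k\<rparr>) = s\<lparr>pc := k + 1\<rparr>"
    using step_nth[of P xs x _ k s] P k x False by simp
  obtain v s'' where v: "v \<le> t"
    "(step P ^^ v) (s\<lparr>pc := k + 1\<rparr>) = s''\<lparr>pc := k + 1 + clen d\<rparr>" "Q s''"
    using runsD[OF d[OF False], of P "xs @ [x]" "k + 1"
        "[Jump (k + clen d + 2 + clen c)] @ comp (k + clen d + 2) c @ ys"] P k by auto
  have 2: "(step P ^^ 1) (s''\<lparr>pc := k + 1 + clen d\<rparr>) = s''\<lparr>pc := k + clen d + 2 + clen c\<rparr>"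
    using step_nth[of P "xs @ [x] @ comp (k + 1) d" "Jump (k + clen d + 2 + clen c)" _
        "k + 1 + clen d" s''] P k by simp
  show ?thesis
    using step_trans[OF step_trans[OF 1 v(2)] 2] v(1,3) t
    by (intro exI[of _ "1 + v + 1"] exI[of _ s'']) (auto simp: algebra_simps)
qed

lemma runs_If:
  assumes "nreg s a \<le> nreg s b \<Longrightarrow> runs c s t Q" "\<not> nreg s a \<le> nreg s b \<Longrightarrow> runs d s t Q" "t + 2 \<le> t'"
  shows "runs (If a b c d) s t' Q"
  by (rule runsI, simp only: comp.simps clen.simps,
      rule branch_run[where B = "\<lambda>s. nreg s a \<le> nreg s b" and s = s and t = t])
    (use assms in auto)

lemma runs_IfR:
  assumes "rreg s a \<le> rreg s b \<Longrightarrow> runs c s t Q" "\<not> rreg s a \<le> rreg s b \<Longrightarrow> runs d s t Q" "t + 2 \<le> t'"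
  shows "runs (IfR a b c d) s t' Q"
  by (rule runsI, simp only: comp.simps clen.simps,
      rule branch_run[where B = "\<lambda>s. rreg s a \<le> rreg s b" and s = s and t = t])
    (use assms in auto)

lemma runs_While_stop:
  assumes "\<not> nreg s a < nreg s b" "1 \<le> t" "Q s"
  shows "runs (While a b c) s t Q"
proof (rule runsI)
  fix P xs k ys assume P: "P = xs @ comp k (While a b c) @ ys" and k: "k = length xs"
  have "(step P ^^ 1) (s\<lparr>pc := k\<rparr>) = s\<lparr>pc := k + clen (While a b c)\<rparr>"
    using step_nth[of P xs "NJumpLe b a (k + clen c + 2)" _ k s] P k assms(1) by simp
  then show "\<exists>t' s'. t' \<le> t \<and> (step P ^^ t') (s\<lparr>pc := k\<rparr>) = s'\<lparr>pc := k + clen (While a b c)\<rparr> \<and> Q s'"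
    using assms by blast
qed

text \<open>The remaining iterations are the postcondition of the body. In this form an induction
  may let one logical step span any number of iterations, as the stack loop requires. The two extra
  units are the test and the jump back.\<close>

lemma runs_While_step:
  assumes "nreg s a < nreg s b" "runs c s t1 (\<lambda>s'. runs (While a b c) s' t2 Q)" "t1 + t2 + 2 \<le> t"
  shows "runs (While a b c) s t Q"
proof (rule runsI)
  fix P xs k ys assume P: "P = xs @ comp k (While a b c) @ ys" and k: "k = length xs"
  have 1: "(step P ^^ 1) (s\<lparr>pc := k\<rparr>) = s\<lparr>pc := k + 1\<rparr>"
    using step_nth[of P xs "NJumpLe b a (k + clen c + 2)" _ k s] P k assms(1) by simp
  obtain u s' where u: "u \<le> t1" "(step P ^^ u) (s\<lparr>pc := k + 1\<rparr>) = s'\<lparr>pc := k + 1 + clen c\<rparr>"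
    "runs (While a b c) s' t2 Q"
    using runsD[OF assms(2), of P "xs @ [NJumpLe b a (k + clen c + 2)]" "k + 1" "[Jump k] @ ys"] P k
    by auto
  have 2: "(step P ^^ 1) (s'\<lparr>pc := k + 1 + clen c\<rparr>) = s'\<lparr>pc := k\<rparr>"
    using step_nth[of P "xs @ [NJumpLe b a (k + clen c + 2)] @ comp (k + 1) c" "Jump k" ys
        "k + 1 + clen c" s'] P k by simp
  obtain v s'' where v: "v \<le> t2" "(step P ^^ v) (s'\<lparr>pc := k\<rparr>) = s''\<lparr>pc := k + clen (While a b c)\<rparr>"
    "Q s''"
    using runsD[OF u(3) P k] by blast
  show "\<exists>t' s'. t' \<le> t \<and> (step P ^^ t') (s\<lparr>pc := k\<rparr>) = s'\<lparr>pc := k + clen (While a b c)\<rparr> \<and> Q s'"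
    using step_trans[OF step_trans[OF step_trans[OF 1 u(2)] 2] v(2)] u(1) v(1,3) assms(3)
    by (intro exI[of _ "1 + u + 1 + v"] exI[of _ s'']) auto
qed

lemma runs_for:
  assumes body: "\<And>k s. k < hi \<Longrightarrow> Inv k s \<Longrightarrow> runs c s tb (Inv (Suc k))"
    and regs: "\<And>k s. Inv k s \<Longrightarrow> nreg s a = k \<and> nreg s b = hi"
    and "Inv lo s" "lo \<le> hi"
    and post: "\<And>s. Inv hi s \<Longrightarrow> Q s" and t: "(hi - lo) * (tb + 2) + 1 \<le> t"
  shows "runs (While a b c) s t Q"
  using \<open>lo \<le> hi\<close> \<open>Inv lo s\<close> t
proof (induction lo arbitrary: s t rule: inc_induct)
  case base
  then show ?case by (intro runs_While_stop) (auto simp: regs post)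
next
  case (step k)
  have *: "(hi - k) * (tb + 2) = tb + 2 + (hi - Suc k) * (tb + 2)"
    using step.hyps by (metis Suc_diff_Suc mult_Suc)
  show ?case
  proof (rule runs_While_step)
    show "nreg s a < nreg s b" using regs step by simp
    show "runs c s tb (\<lambda>s'. runs (While a b c) s' ((hi - Suc k) * (tb + 2) + 1) Q)"
      by (rule runs_conseq[OF body]) (use step in auto)
  qed (use * step.prems in linarith)
qed

lemma runs_halts:
  assumes "runs c s t Q" "pc s = 0"
  obtains t' s' where "t' \<le> t" "halts_within (comp 0 c) t' s (s'\<lparr>pc := clen c\<rparr>)" "Q s'"
proof -
  obtain t' s' where "t' \<le> t" "(step (comp 0 c) ^^ t') (s\<lparr>pc := 0\<rparr>) = s'\<lparr>pc := 0 + clen c\<rparr>" "Q s'"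
    using runsD[OF assms(1), of "comp 0 c" "[]" 0 "[]"] by auto
  moreover have "s\<lparr>pc := 0\<rparr> = s" using assms(2) by simp
  ultimately show thesis
    by (intro that[of t' s']) (auto simp: halts_within_def halted_def)
qed

section \<open>Mixed radix numbers\<close>

text \<open>The place value of level \<open>l\<close>, counted from 1. A level of size 0 contributes
  the factor 1, so it shares its place value with the next level; several later arguments have to
  steer around this.\<close>

definition radix :: "(nat \<Rightarrow> nat) \<Rightarrow> nat \<Rightarrow> nat" where
  "radix m l = (\<Prod>k=1..<l. m k + 1)"

lemma radix_0 [simp]: "radix m 0 = 1" and radix_1 [simp]: "radix m (Suc 0) = 1"
  by (simp_all add: radix_def)

lemma radix_Suc: "0 < l \<Longrightarrow> radix m (Suc l) = radix m l * (m l + 1)"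
  by (cases l) (simp_all add: radix_def)

lemma radix_pos [simp]: "0 < radix m l"
  by (simp add: radix_def)

lemma radix_mono: "l \<le> l' \<Longrightarrow> radix m l \<le> radix m l'"
proof (induction rule: dec_induct)
  case (step k)
  then show ?case by (cases "k = 0") (auto simp: radix_Suc)
qed simp

lemma mixed_radix_less:
  "(\<And>l. l \<in> {1..<j} \<Longrightarrow> u l \<le> m l) \<Longrightarrow> (\<Sum>l=1..<j. u l * radix m l) < radix m j"
proof (induction j)
  case (Suc j)
  show ?case
  proof (cases "j = 0")
    case False
    have "(\<Sum>l=1..<j. u l * radix m l) < radix m j" using Suc by simp
    moreover have "u j * radix m j \<le> m j * radix m j" using Suc.prems[of j] False by simp
    moreover have "radix m (Suc j) = radix m j + m j * radix m j"
      "(\<Sum>l=1..<Suc j. u l * radix m l) = (\<Sum>l=1..<j. u l * radix m l) + u j * radix m j"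
      using False by (simp_all add: radix_Suc)
    ultimately show ?thesis by linarith
  qed simp
qed simp

text \<open>The carry \<open>d\<close> out of the digits below \<open>j\<close> makes the induction work; only \<open>d = 0\<close> is of interest.\<close>

lemma mixed_radix_minimal:
  assumes "\<And>l. l \<in> {1..<j} \<Longrightarrow> u l \<le> m l" "\<And>l. l \<in> {1..<j} \<Longrightarrow> m l = 0 \<Longrightarrow> v l = 0"
    and "(\<Sum>l=1..<j. v l * radix m l) = d * radix m j + (\<Sum>l=1..<j. u l * radix m l)"
  shows "d + sum u {1..<j} \<le> sum v {1..<j} \<and>
    (d + sum u {1..<j} = sum v {1..<j} \<longrightarrow> d = 0 \<and> (\<forall>l\<in>{1..<j}. v l = u l))"
  using assms
proof (induction j arbitrary: d)
  case (Suc j)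
  show ?case
  proof (cases "j = 0")
    case True
    then show ?thesis using Suc.prems(3) by simp
  next
    case False
    let ?U = "\<Sum>l=1..<j. u l * radix m l" and ?V = "\<Sum>l=1..<j. v l * radix m l"
    \<comment> \<open>The lower digits of \<open>v\<close> have to make up for \<open>d'\<close>
      units of position \<open>j\<close>; \<open>le\<close> below shows that the subtraction is not
      truncated.\<close>
    define d' where "d' = d * (m j + 1) + u j - v j"
    have eq: "?V + v j * radix m j = (d * (m j + 1) + u j) * radix m j + ?U"
      using Suc.prems(3) False by (simp add: radix_Suc algebra_simps)
    have "?U < radix m j" using Suc.prems(1) by (intro mixed_radix_less) simp
    then have "v j * radix m j < (d * (m j + 1) + u j + 1) * radix m j"
      using eq by (simp add: algebra_simps)
    then have le: "v j \<le> d * (m j + 1) + u j" by (simp only: mult_less_cancel2) linarith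
    then have vd: "d * (m j + 1) + u j = v j + d'" by (simp add: d'_def)
    have "?V = d' * radix m j + ?U" using eq unfolding vd by (simp add: algebra_simps)
    then have IH: "d' + sum u {1..<j} \<le> sum v {1..<j} \<and>
      (d' + sum u {1..<j} = sum v {1..<j} \<longrightarrow> d' = 0 \<and> (\<forall>l\<in>{1..<j}. v l = u l))"
      by (intro Suc.IH Suc.prems(1,2)) simp_all
    have sums: "sum u {1..<Suc j} = u j + sum u {1..<j}" "sum v {1..<Suc j} = v j + sum v {1..<j}"
      using False by simp_all
    have dd: "d * (m j + 1) = d + d * m j" by simp
    \<comment> \<open>Breaking a carry of \<open>d\<close> into units of position \<open>j\<close>
      costs \<open>d * m j\<close> additional digits, so equality of the sums forces
      \<open>d * m j = 0\<close>. If \<open>m j = 0\<close>, then \<open>v j = 0\<close> leaves no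
      room for a carry.\<close>
    have "d * m j = 0 \<Longrightarrow> d' = 0 \<Longrightarrow> d = 0 \<and> v j = u j"
      using vd Suc.prems(1,2)[of j] False by (cases "m j = 0") simp_all
    moreover have "d * m j = 0 \<and> d' + sum u {1..<j} = sum v {1..<j}"
      if "d + sum u {1..<Suc j} = sum v {1..<Suc j}"
      using that IH sums vd dd by linarith
    moreover have "(\<forall>l\<in>{1..<Suc j}. v l = u l) \<longleftrightarrow> v j = u j \<and> (\<forall>l\<in>{1..<j}. v l = u l)"
      using False by (auto simp: less_Suc_eq)
    ultimately have "d + sum u {1..<Suc j} = sum v {1..<Suc j} \<Longrightarrow>
        d = 0 \<and> (\<forall>l\<in>{1..<Suc j}. v l = u l)"
      using IH by presburger
    moreover have "d + sum u {1..<Suc j} \<le> sum v {1..<Suc j}"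
      using IH sums vd dd by linarith
    ultimately show ?thesis by blast
  qed
qed simp

text \<open>Digits are split off from the top. At a level of size 0 the remainder is already below
  the place value, so its digit is 0 for every argument below the radix of the whole range.\<close>

fun digit_sum :: "(nat \<Rightarrow> nat) \<Rightarrow> nat \<Rightarrow> nat \<Rightarrow> nat" where
  "digit_sum m 0 c = 0"
| "digit_sum m (Suc l) c = c div radix m (Suc l) + digit_sum m l (c mod radix m (Suc l))"

lemma digit_sum_0 [simp]: "digit_sum m l 0 = 0"
  by (induction l) auto

lemma digit_sum_higher: "l \<le> l' \<Longrightarrow> c < radix m (Suc l) \<Longrightarrow> digit_sum m l' c = digit_sum m l c"
proof (induction rule: dec_induct)
  case (step k)
  then have "c < radix m (Suc k)" using radix_mono[of "Suc l" "Suc k" m] by simp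
  then show ?case using step by simp
qed simp

text \<open>Only the leading digit changes: the two bounds on \<open>c\<close> make \<open>l\<close>
  its level and force \<open>m l\<close> to be positive. This is both the rule by which the table of
  digit sums is filled and the source of a first candidate.\<close>

lemma digit_sum_step:
  assumes "0 < l" "l \<le> h" "radix m l \<le> c" "c < radix m (Suc l)"
  shows "digit_sum m h c = Suc (digit_sum m h (c - radix m l))"
proof -
  obtain k where k: "l = Suc k" using assms(1) by (cases l) auto
  have "digit_sum m l c = Suc (digit_sum m l (c - radix m l))"
    using assms(3) by (simp add: k le_div_geq le_mod_geq)
  then show ?thesis using digit_sum_higher[OF assms(2)] assms(4) by simp
qed

lemma digit_sum_value:
  "(\<And>k. k \<in> {1..l} \<Longrightarrow> u k \<le> m k) \<Longrightarrow> digit_sum m l (\<Sum>k=1..l. u k * radix m k) = sum u {1..l}"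
proof (induction l)
  case (Suc l)
  have "(\<Sum>k=1..<Suc l. u k * radix m k) < radix m (Suc l)"
    using Suc.prems by (intro mixed_radix_less) simp
  then have "(\<Sum>k=1..l. u k * radix m k) < radix m (Suc l)" by (simp add: atLeastLessThanSuc_atLeastAtMost)
  then show ?case using Suc by simp
qed simp

section \<open>Recursive form of the cost\<close>

fun gap_weight :: "(nat \<Rightarrow> real) \<Rightarrow> bst \<Rightarrow> real" where
  "gap_weight q (Ext j) = q j"
| "gap_weight q (Node l k r) = 0"

text \<open>The sum rearranged by internal nodes: an external node is paid for at the address of its
  parent, so its weight joins the factor of the parent and the leaf itself costs 0.\<close>

fun tree_cost :: "(nat \<Rightarrow> real) \<Rightarrow> (nat \<Rightarrow> real) \<Rightarrow> (nat \<Rightarrow> real) \<Rightarrow> bst \<Rightarrow> real" where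
  "tree_cost p q g (Ext j) = 0"
| "tree_cost p q g (Node l k r) =
     g k * (weight p q (Node l k r) + gap_weight q l + gap_weight q r)
     + tree_cost p q g l + tree_cost p q g r"

lemma tree_cost_cong:
  "(\<And>k. k \<in> set (int_labels T) \<Longrightarrow> g k = g' k) \<Longrightarrow> tree_cost p q g T = tree_cost p q g' T"
  by (induction T) auto

lemma in_nodes [simp]:
  "Key k \<in> nodes T \<longleftrightarrow> k \<in> set (int_labels T)" "Gap j \<in> nodes T \<longleftrightarrow> j \<in> set (ext_labels T)"
  by (auto simp: nodes_def)

definition gap_cost :: "(nat \<Rightarrow> real) \<Rightarrow> (nat \<Rightarrow> real) \<Rightarrow> (nat \<Rightarrow> real) \<Rightarrow> bst \<Rightarrow> real" where
  "gap_cost p q g T =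
     (\<Sum>j\<in>set (ext_labels T). weight p q (subtree T (Gap j)) * g (ext_parent T j))"

definition key_cost :: "(nat \<Rightarrow> real) \<Rightarrow> (nat \<Rightarrow> real) \<Rightarrow> (nat \<Rightarrow> real) \<Rightarrow> bst \<Rightarrow> real" where
  "key_cost p q g T = (\<Sum>k\<in>set (int_labels T). weight p q (subtree T (Key k)) * g k)"

lemma key_cost_Node:
  assumes "distinct (int_labels (Node l k r))"
  shows "key_cost p q g (Node l k r) =
    weight p q (Node l k r) * g k + key_cost p q g l + key_cost p q g r"
proof -
  have "(\<Sum>i\<in>set (int_labels l). weight p q (subtree (Node l k r) (Key i)) * g i) = key_cost p q g l"
    "(\<Sum>i\<in>set (int_labels r). weight p q (subtree (Node l k r) (Key i)) * g i) = key_cost p q g r"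
    unfolding key_cost_def using assms by (auto intro!: sum.cong)
  moreover have "set (int_labels (Node l k r)) = insert k (set (int_labels l) \<union> set (int_labels r))"
    by auto
  ultimately show ?thesis
    using assms by (simp add: key_cost_def[of _ _ _ "Node l k r"] sum.union_disjoint del: int_labels.simps)
      (simp add: sum.union_disjoint)
qed

lemma gap_cost_Node:
  assumes "distinct (ext_labels (Node l k r))"
  shows "gap_cost p q g (Node l k r) =
    (case l of Ext j \<Rightarrow> q j * g k | _ \<Rightarrow> gap_cost p q g l) +
    (case r of Ext j \<Rightarrow> q j * g k | _ \<Rightarrow> gap_cost p q g r)"
proof -
  have "(\<Sum>j\<in>set (ext_labels l). weight p q (subtree (Node l k r) (Gap j)) * g (ext_parent (Node l k r) j))
    = (case l of Ext j \<Rightarrow> q j * g k | _ \<Rightarrow> gap_cost p q g l)"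
    using assms by (cases l) (auto simp: gap_cost_def weight_def intro!: sum.cong)
  moreover have "(\<Sum>j\<in>set (ext_labels r). weight p q (subtree (Node l k r) (Gap j)) * g (ext_parent (Node l k r) j))
    = (case r of Ext j \<Rightarrow> q j * g k | _ \<Rightarrow> gap_cost p q g r)"
    using assms by (cases r) (auto simp: gap_cost_def weight_def intro!: sum.cong)
  ultimately show ?thesis
    using assms by (simp add: gap_cost_def[of _ _ _ "Node l k r"] sum.union_disjoint
        del: subtree.simps ext_parent.simps)
qed

text \<open>A lone external node has no parent and hence no meaningful gap cost. It is excluded, and
  the induction treats leaf children by a case split instead of the induction hypothesis.\<close>

lemma tree_cost_eq:
  assumes "distinct (int_labels T)" "distinct (ext_labels T)" "\<nexists>j. T = Ext j"
  shows "key_cost p q g T + gap_cost p q g T = tree_cost p q g T"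
  using assms
proof (induction T)
  case (Node l k r)
  have "key_cost p q g l + (case l of Ext j \<Rightarrow> q j * g k | _ \<Rightarrow> gap_cost p q g l)
      = tree_cost p q g l + gap_weight q l * g k"
    using Node by (cases l) (auto simp: key_cost_def[of _ _ _ "Ext _"])
  moreover have "key_cost p q g r + (case r of Ext j \<Rightarrow> q j * g k | _ \<Rightarrow> gap_cost p q g r)
      = tree_cost p q g r + gap_weight q r * g k"
    using Node by (cases r) (auto simp: key_cost_def[of _ _ _ "Ext _"])
  ultimately show ?case
    using Node.prems by (simp add: key_cost_Node gap_cost_Node algebra_simps)
qed simp

section \<open>Trees over an interval of keys\<close>

definition spans :: "bst \<Rightarrow> nat \<Rightarrow> nat \<Rightarrow> bool" where
  "spans T i s \<longleftrightarrow> int_labels T = [i+1..<i+s+1] \<and> ext_labels T = [i..<i+s+1]"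

lemma length_ext_labels: "length (ext_labels T) = Suc (length (int_labels T))"
  by (induction T) auto

lemma spans_Ext [simp]: "spans (Ext j) i s \<longleftrightarrow> j = i \<and> s = 0"
proof
  assume "spans (Ext j) i s"
  then have "[i+1..<i+s+1] = []" "[j] = [i..<i+s+1]" by (simp_all only: spans_def int_labels.simps ext_labels.simps)
  then show "j = i \<and> s = 0" by (simp add: upt_conv_Cons del: upt_Suc)
qed (simp add: spans_def)

lemma spans_NodeI:
  assumes "spans l i s" "spans r (i + s + 1) s'"
  shows "spans (Node l (i + s + 1) r) i (s + s' + 1)"
proof -
  have *: "[a..<i+s+1+(s'+1)] = [a..<i+s+1] @ [i+s+1..<i+s+1+(s'+1)]" if "a \<le> i + s + 1" for a
    by (rule upt_add_eq_append[OF that])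
  have "[i+s+1..<i+s+1+(s'+1)] = (i+s+1) # [i+s+1+1..<i+s+1+(s'+1)]"
    by (subst upt_conv_Cons) simp_all
  then have "[i+1..<i+s+1+(s'+1)] = [i+1..<i+s+1] @ (i+s+1) # [i+s+1+1..<i+s+1+(s'+1)]"
    using *[of "i + 1"] by simp
  moreover have "i + (s + s' + 1) + 1 = i+s+1+(s'+1)" by simp
  ultimately show ?thesis using assms *[of i] by (simp only: spans_def int_labels.simps ext_labels.simps) simp
qed

lemma spans_NodeE:
  assumes "spans (Node l k r) i s"
  obtains s1 s2 where "spans l i s1" "spans r (i + s1 + 1) s2" "k = i + s1 + 1" "s = s1 + s2 + 1"
proof -
  define s1 s2 where "s1 = length (int_labels l)" and "s2 = length (int_labels r)"
  have I: "int_labels l @ k # int_labels r = [i+1..<i+s+1]"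
    and E: "ext_labels l @ ext_labels r = [i..<i+s+1]"
    using assms by (auto simp: spans_def)
  have s: "s = s1 + s2 + 1"
    using arg_cong[OF I, of length] by (simp add: s1_def s2_def)
  \<comment> \<open>A tree has one more external than internal node, so the two label lists are cut
    at \<open>s1\<close> and at \<open>Suc s1\<close>.\<close>
  have "int_labels l = take s1 [i+1..<i+s+1]" "k # int_labels r = drop s1 [i+1..<i+s+1]"
    unfolding I[symmetric] by (auto simp: s1_def)
  moreover have "ext_labels l = take (Suc s1) [i..<i+s+1]" "ext_labels r = drop (Suc s1) [i..<i+s+1]"
    unfolding E[symmetric] by (auto simp: s1_def length_ext_labels)
  ultimately have *: "int_labels l = [i+1..<i+s1+1]" "k # int_labels r = [i+s1+1..<i+s+1]"
    "ext_labels l = [i..<i+s1+1]" "ext_labels r = [i+s1+1..<i+s+1]"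
    using s by (auto simp: take_upt drop_upt add.commute simp del: upt_Suc)
  have "[i+s1+1..<i+s+1] = (i+s1+1) # [i+s1+1+1..<i+s+1]"
    using s by (subst upt_conv_Cons) simp_all
  with *(2) have "k = i+s1+1" "int_labels r = [i+s1+1+1..<i+s1+1+s2+1]"
    using s by (simp_all add: add_ac)
  moreover have "ext_labels r = [i+s1+1..<i+s1+1+s2+1]"
    using *(4) s by (simp add: add_ac)
  ultimately show thesis
    using s * by (intro that[of s1 s2]) (simp_all only: spans_def)
qed

lemma spans_set: "spans T i s \<Longrightarrow> set (int_labels T) = {i+1..i+s} \<and> set (ext_labels T) = {i..i+s}"
  by (auto simp: spans_def)

section \<open>The recurrence\<close>

text \<open>Absorbs one factor \<open>2 ^ h\<close> of \<open>N * N\<close> into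
  \<open>h ^ h\<close>; the factor 2 on the right accounts for \<open>h = 1\<close>.\<close>

lemma two_power_le_self_power: "2 ^ h \<le> 2 * (h::nat) ^ h" if "1 \<le> h"
proof (cases "h = 1")
  case False
  then have "(2::nat) ^ h \<le> h ^ h" using that by (intro power_mono) auto
  then show ?thesis by linarith
qed simp

text \<open>The inequality of arithmetic and geometric means: after division by the mean
  \<open>a\<close>, each factor \<open>x\<close> is at most \<open>exp (x - 1)\<close>, and these
  exponents sum to 0.\<close>

lemma prod_le_mean_power:
  assumes "finite A" "A \<noteq> {}" "\<And>x. x \<in> A \<Longrightarrow> 0 \<le> (f x :: real)" "0 < sum f A"
  shows "prod f A \<le> (sum f A / card A) ^ card A"
proof -
  define a where "a = sum f A / card A"
  have card: "0 < card A" using assms by (simp add: card_gt_0_iff)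
  then have a: "0 < a" using assms by (simp add: a_def)
  have "(\<Prod>x\<in>A. f x / a) \<le> (\<Prod>x\<in>A. exp (f x / a - 1))"
    using a assms(3) exp_ge_add_one_self by (intro prod_mono) (metis add.commute diff_add_cancel divide_nonneg_pos)
  also have "\<dots> = exp (\<Sum>x\<in>A. f x / a - 1)" using assms(1) by (simp add: exp_sum)
  also have "(\<Sum>x\<in>A. f x / a - 1) = sum f A / a - card A"
    by (simp add: sum_subtractf sum_divide_distrib)
  also have "sum f A / a = card A"
    using card assms(4) by (simp add: a_def)
  finally have "prod f A / a ^ card A \<le> 1" by (simp add: prod_dividef)
  then show ?thesis using a by (simp add: a_def[symmetric] field_simps)
qed

section \<open>Codes of level choices for a fixed instance\<close>

locale hmm =
  fixes I :: hmm_problem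
  assumes valid: "valid_problem I"
begin

abbreviation "n \<equiv> nkeys I"
abbreviation "h \<equiv> nlevels I"
abbreviation "m \<equiv> lsize I"
abbreviation "C \<equiv> lcost I"
abbreviation "p \<equiv> prob_key I"
abbreviation "q \<equiv> prob_gap I"

definition B :: "nat \<Rightarrow> nat" where "B = radix m"
definition N :: nat where "N = radix m (Suc h)"
definition S :: "nat \<Rightarrow> nat" where "S = digit_sum m h"
definition PS :: "nat \<Rightarrow> real" where "PS k = (\<Sum>x=1..k. p x) + (\<Sum>x=0..k. q x)"

lemma n_pos: "1 \<le> n" and h_pos: "1 \<le> h" and h_le_n: "h \<le> n" and sum_m: "sum m {1..h} = n"
  using valid by (auto simp: valid_problem_def)

lemma B_1 [simp]: "B (Suc 0) = 1" and B_pos [simp]: "0 < B l" and N_pos [simp]: "0 < N"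
  and B_Suc: "0 < l \<Longrightarrow> B (Suc l) = B l * (m l + 1)" and N_eq: "N = B (Suc h)"
  by (simp_all add: B_def N_def radix_Suc)

lemma B_neq_0 [simp]: "B l \<noteq> 0"
  by (simp add: B_def)

lemma S_0 [simp]: "S 0 = 0"
  by (simp add: S_def)

lemma S_step: "1 \<le> l \<Longrightarrow> l \<le> h \<Longrightarrow> B l \<le> c \<Longrightarrow> c < B (Suc l) \<Longrightarrow> S c = Suc (S (c - B l))"
  unfolding B_def S_def by (rule digit_sum_step) auto

lemma digits:
  assumes "\<And>l. l \<in> {1..h} \<Longrightarrow> u l \<le> m l"
  shows "(\<Sum>l=1..h. u l * B l) < N" "S (\<Sum>l=1..h. u l * B l) = sum u {1..h}"
  using mixed_radix_less[of "Suc h" u m] digit_sum_value[of h u m] assms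
  by (auto simp: B_def N_def S_def atLeastLessThanSuc_atLeastAtMost)

text \<open>The greatest \<open>l\<close> with \<open>B l \<le> c\<close> is the position of the
  leading digit; choosing the greatest skips levels of size 0, which share their place value with
  the next one.\<close>

lemma level_of_code:
  assumes "0 < c" "c < N"
  obtains l where "1 \<le> l" "l \<le> h" "B l \<le> c" "c < B (Suc l)"
proof -
  define l where "l = (GREATEST l. l \<le> h \<and> B l \<le> c)"
  have effect: "1 \<le> h \<and> B 1 \<le> c" using assms h_pos by simp
  have l: "l \<le> h \<and> B l \<le> c" unfolding l_def by (rule GreatestI_nat[of _ 1 h]) (use effect in auto)
  have max: "k \<le> l" if "k \<le> h \<and> B k \<le> c" for k
    unfolding l_def by (rule Greatest_le_nat[of _ k h]) (use that in auto)
  show thesis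
  proof (rule that[of l])
    show "1 \<le> l" by (rule max[OF effect])
    show "c < B (Suc l)"
      using max[of "Suc l"] l assms(2) by (cases "l = h") (auto simp: N_eq intro: leI)
  qed (use l in auto)
qed

text \<open>Groups keys by level: with \<open>f = B\<close> a sum of place values becomes a mixed
  radix number, with \<open>f\<close> constantly 1 it becomes a count of keys.\<close>

lemma sum_levels:
  assumes "finite A" "\<And>k. k \<in> A \<Longrightarrow> lev k \<in> {1..h}"
  shows "(\<Sum>k\<in>A. f (lev k)) = (\<Sum>l=1..h. card {k \<in> A. lev k = l} * f l :: nat)"
proof -
  have "(\<Sum>l=1..h. card {k \<in> A. lev k = l} * f l) = (\<Sum>l=1..h. \<Sum>k | k \<in> A \<and> lev k = l. f (lev k))"
    by (intro sum.cong) auto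
  also have "\<dots> = (\<Sum>k\<in>A. f (lev k))"
    using assms by (intro sum.group) auto
  finally show ?thesis by simp
qed

lemma code_of_levels:
  assumes "finite A" "\<And>k. k \<in> A \<Longrightarrow> lev k \<in> {1..h}"
    and "\<And>l. l \<in> {1..h} \<Longrightarrow> card {k \<in> A. lev k = l} \<le> m l"
  shows "(\<Sum>k\<in>A. B (lev k)) < N" "S (\<Sum>k\<in>A. B (lev k)) = card A"
  using digits[of "\<lambda>l. card {k \<in> A. lev k = l}"] assms sum_levels[of A lev B] sum_levels[of A lev "\<lambda>_. 1"]
  by auto

lemma full_code: "(\<Sum>l=1..h. m l * B l) = N - 1" and S_full: "S (N - 1) = n"
proof -
  have "(\<Sum>l=1..<j. m l * radix m l) = radix m j - 1" for j
  proof (induction j)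
    case (Suc j)
    obtain r where "radix m j = Suc r" using radix_pos gr0_implies_Suc by blast
    then show ?case using Suc by (cases "j = 0") (auto simp: radix_Suc)
  qed simp
  from this[of "Suc h"] show *: "(\<Sum>l=1..h. m l * B l) = N - 1"
    by (simp add: B_def N_def atLeastLessThanSuc_atLeastAtMost)
  show "S (N - 1) = n" using digits(2)[of m] * sum_m by simp
qed

lemma levels_of_full_code:
  assumes "\<And>k. k \<in> {1..n} \<Longrightarrow> lev k \<in> {1..h} \<and> 1 \<le> m (lev k)" "(\<Sum>k=1..n. B (lev k)) = N - 1"
    and "l \<in> {1..h}"
  shows "card {k \<in> {1..n}. lev k = l} = m l"
proof -
  let ?v = "\<lambda>l. card {k \<in> {1..n}. lev k = l}"
  have "(\<Sum>l=1..h. ?v l * B l) = (\<Sum>l=1..h. m l * B l)"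
    using sum_levels[of "{1..n}" lev B] assms full_code by simp
  moreover have "sum ?v {1..h} = sum m {1..h}"
    using sum_levels[of "{1..n}" lev "\<lambda>_. 1"] assms sum_m by simp
  moreover have "?v l = 0" if "m l = 0" for l
  proof -
    have "{k \<in> {1..n}. lev k = l} = {}" using that assms(1) by force
    then show ?thesis by simp
  qed
  ultimately show ?thesis
    using mixed_radix_minimal[of "Suc h" m m ?v 0] assms(3)
    by (simp add: B_def atLeastLessThanSuc_atLeastAtMost)
qed

text \<open>\<open>PS i\<close> already contains \<open>q i\<close>, whereas the interval starts
  with that gap; hence \<open>q i\<close> is added back.\<close>

lemma weight_spans: "spans T i s \<Longrightarrow> weight p q T = PS (i + s) - PS i + q i"
proof -
  have "(\<Sum>x=i+1..i+s. p x) = (\<Sum>x=1..i+s. p x) - (\<Sum>x=1..i. p x)"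
    by (induction s) auto
  moreover have "(\<Sum>x=i..i+s. q x) = (\<Sum>x=0..i+s. q x) - (\<Sum>x=0..i. q x) + q i"
    by (induction s) auto
  ultimately show "spans T i s \<Longrightarrow> ?thesis"
    by (simp add: weight_def spans_set PS_def)
qed

lemma gap_weight_spans: "spans T i s \<Longrightarrow> gap_weight q T = (if s = 0 then q i else 0)"
  by (cases T) (auto elim: spans_NodeE)

text \<open>Without \<open>1 \<le> m l\<close> a level of size 0 could stand in for a later level
  with the same place value, at a lower cost. The second conjunct keeps the natural subtraction
  exact.\<close>

definition cand :: "nat \<Rightarrow> nat \<Rightarrow> nat \<Rightarrow> bool" where
  "cand c l a \<longleftrightarrow> 1 \<le> m l \<and> a + B l \<le> c \<and> S a + S (c - (a + B l)) + 1 = S c"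

text \<open>The cell of code \<open>c\<close> and start \<open>i\<close> has the number
  \<open>c * (n + 1) + i\<close>. The root is key \<open>i + S a + 1\<close>, and the same number is
  the start of the right subtree. A child of code 0 is a leaf, whose weight \<open>q i\<close> or
  \<open>q (i + S c)\<close> is charged to the root.\<close>

definition cval :: "(nat \<Rightarrow> real) \<Rightarrow> nat \<Rightarrow> nat \<Rightarrow> nat \<Rightarrow> nat \<Rightarrow> real" where
  "cval D c i l a = real (C l) * (PS (i + S c) - PS i + q i + (if a = 0 then q i else 0)
       + (if c - (a + B l) = 0 then q (i + S c) else 0))
     + D (a * (n + 1) + i) + D ((c - (a + B l)) * (n + 1) + (i + S a + 1))"

text \<open>Level \<open>l = 0\<close> means that no candidate has been found in \<open>X\<close>.\<close>

definition best :: "(nat \<times> nat) set \<Rightarrow> (nat \<Rightarrow> real) \<Rightarrow> nat \<Rightarrow> nat \<Rightarrow> nat \<Rightarrow> nat \<Rightarrow> real \<Rightarrow> bool" where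
  "best X D c i l a v \<longleftrightarrow>
     (if l = 0 then v = 0 \<and> (\<forall>(l', a') \<in> X. \<not> cand c l' a')
      else (l, a) \<in> X \<and> cand c l a \<and> v = cval D c i l a \<and>
        (\<forall>(l', a') \<in> X. cand c l' a' \<longrightarrow> v \<le> cval D c i l' a'))"

text \<open>The Bellman equation of one cell. \<open>D\<close> occurs on both sides, but the
  candidates refer only to smaller codes.\<close>

definition dp_ok :: "(nat \<Rightarrow> real) \<Rightarrow> (nat \<Rightarrow> nat) \<Rightarrow> (nat \<Rightarrow> nat) \<Rightarrow> nat \<Rightarrow> nat \<Rightarrow> bool" where
  "dp_ok D L A c i \<longleftrightarrow> best ({1..h} \<times> {..<N}) D c i
     (L (c * (n + 1) + i)) (A (c * (n + 1) + i)) (D (c * (n + 1) + i))"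

text \<open>Putting the root on the level of the leading digit and everything else into the right
  subtree never carries. Consequently level 0 is recorded for code 0 alone and can serve as the mark
  of a leaf.\<close>

lemma cand_exists:
  assumes "0 < c" "c < N"
  obtains l where "l \<in> {1..h}" "cand c l 0"
proof -
  obtain l where l: "1 \<le> l" "l \<le> h" "B l \<le> c" "c < B (Suc l)"
    using level_of_code[OF assms] .
  then have "1 \<le> m l" by (cases "m l = 0") (auto simp: B_Suc)
  then have "cand c l 0" using l S_step[OF l] by (simp add: cand_def)
  then show thesis using that[of l] l by simp
qed

lemma dp_ok_0: "dp_ok D L A 0 i \<Longrightarrow> L i = 0 \<and> D i = 0"
proof -
  assume ok: "dp_ok D L A 0 i"
  have "\<not> cand 0 l a" for l a using B_pos[of l] by (auto simp: cand_def)
  then show ?thesis using ok by (auto simp: dp_ok_def best_def split: if_splits)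
qed

lemma dp_ok_pos:
  assumes "dp_ok D L A c i" "0 < c" "c < N"
  defines "y \<equiv> c * (n + 1) + i"
  shows "L y \<in> {1..h}" "A y < N" "cand c (L y) (A y)" "D y = cval D c i (L y) (A y)"
    "\<And>l a. l \<in> {1..h} \<Longrightarrow> a < N \<Longrightarrow> cand c l a \<Longrightarrow> D y \<le> cval D c i l a"
proof -
  obtain l where l: "l \<in> {1..h}" "cand c l 0" using cand_exists[OF assms(2,3)] .
  have b: "best ({1..h} \<times> {..<N}) D c i (L y) (A y) (D y)"
    using assms(1) unfolding dp_ok_def y_def .
  have "L y \<noteq> 0"
  proof
    assume "L y = 0"
    then have "\<forall>(l, a) \<in> {1..h} \<times> {..<N}. \<not> cand c l a" using b by (simp add: best_def)
    then show False using l N_pos by blast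
  qed
  then show "L y \<in> {1..h}" "A y < N" "cand c (L y) (A y)" "D y = cval D c i (L y) (A y)"
    "\<And>l a. l \<in> {1..h} \<Longrightarrow> a < N \<Longrightarrow> cand c l a \<Longrightarrow> D y \<le> cval D c i l a"
    using b by (auto simp: best_def)
qed

text \<open>Any level function that respects the capacities can be followed down the tree: the codes
  of the two subtrees and of the root add up without carries, so the root level and the left code
  form one of the candidates over which the cell was minimised.\<close>

lemma dp_lower_bound:
  assumes dp: "\<And>c i. c < N \<Longrightarrow> i + S c \<le> n \<Longrightarrow> dp_ok D L A c i"
    and "spans T i s" "i + s \<le> n"
    and "\<And>k. k \<in> {i+1..i+s} \<Longrightarrow> lev k \<in> {1..h}"
    and "\<And>l. l \<in> {1..h} \<Longrightarrow> card {k \<in> {i+1..i+s}. lev k = l} \<le> m l"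
  shows "D ((\<Sum>k=i+1..i+s. B (lev k)) * (n + 1) + i) \<le> tree_cost p q (\<lambda>k. real (C (lev k))) T"
  using assms(2-)
proof (induction T arbitrary: i s)
  case (Ext j)
  then have "s = 0" by simp
  then show ?case using dp_ok_0[OF dp[of 0 i]] Ext by simp
next
  case (Node l k r)
  obtain s1 s2 where sp: "spans l i s1" "spans r (i + s1 + 1) s2" and k: "k = i + s1 + 1"
    and s: "s = s1 + s2 + 1" using spans_NodeE[OF Node.prems(1)] .
  define X where "X = {i+1..i+s}"
  define X1 where "X1 = {i+1..i+s1}"
  define X2 where "X2 = {k+1..k+s2}"
  define a where "a = (\<Sum>k\<in>X1. B (lev k))"
  define b where "b = (\<Sum>k\<in>X2. B (lev k))"
  define c where "c = (\<Sum>k\<in>X. B (lev k))"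
  have X: "X = insert k (X1 \<union> X2)" and disj: "k \<notin> X1 \<union> X2" "X1 \<inter> X2 = {}"
    and fin: "finite X" "finite X1" "finite X2"
    unfolding X_def X1_def X2_def k s by auto
  have c: "c = B (lev k) + (a + b)"
    unfolding c_def a_def b_def X using disj fin by (subst sum.insert) (auto simp: sum.union_disjoint)
  have lev: "lev x \<in> {1..h}" if "x \<in> X" for x using Node.prems(3) that unfolding X_def by blast
  have count: "card {x \<in> X. lev x = j} \<le> m j" if "j \<in> {1..h}" for j
    using Node.prems(4)[OF that] unfolding X_def .
  have count': "card {x \<in> Y. lev x = j} \<le> m j" if "j \<in> {1..h}" "Y \<subseteq> X" for j Y
    by (rule order_trans[OF card_mono count[OF that(1)]]) (use that fin in auto)
  have codes': "(\<Sum>k\<in>Y. B (lev k)) < N \<and> S (\<Sum>k\<in>Y. B (lev k)) = card Y" if "Y \<subseteq> X" for Y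
    using code_of_levels[of Y lev] lev count' that finite_subset[OF that fin(1)] by blast
  have cards: "card X1 = s1" "card X2 = s2" "card X = s"
    by (simp_all add: X1_def X2_def X_def)
  have codes: "a < N" "S a = s1" "b < N" "S b = s2" "c < N" "S c = s"
    using codes'[of X1] codes'[of X2] codes'[of X] X cards unfolding a_def b_def c_def by auto
  \<comment> \<open>The root itself occupies a place of its level, so that level has positive
    size.\<close>
  have "card {x \<in> {k}. lev x = lev k} \<le> m (lev k)" using lev X by (intro count') auto
  moreover have "{x \<in> {k}. lev x = lev k} = {k}" by auto
  ultimately have "1 \<le> m (lev k)" by simp
  then have cand: "cand c (lev k) a" using codes s by (simp add: cand_def c)
  \<comment> \<open>The recurrence recognises a leaf by code 0, \<open>gap_weight\<close> by size 0;
    the two agree because every place value is positive.\<close>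
  have code_eq_0: "(\<Sum>k\<in>Y. B (lev k)) = 0 \<longleftrightarrow> card Y = 0" if "finite Y" for Y
    using that by auto
  have a0: "a = 0 \<longleftrightarrow> s1 = 0" and b0: "b = 0 \<longleftrightarrow> s2 = 0"
    using code_eq_0[OF fin(2)] code_eq_0[OF fin(3)] cards by (simp_all add: a_def b_def)
  have IH1: "D (a * (n + 1) + i) \<le> tree_cost p q (\<lambda>k. real (C (lev k))) l"
    unfolding a_def X1_def
  proof (rule Node.IH(1)[OF sp(1)])
    show "card {x \<in> {i+1..i+s1}. lev x = j} \<le> m j" if "j \<in> {1..h}" for j
      using count'[OF that, of X1] X unfolding X1_def by blast
    show "lev x \<in> {1..h}" if "x \<in> {i+1..i+s1}" for x
      using lev that X unfolding X1_def by blast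
  qed (use s Node.prems(2) in simp)
  have IH2: "D (b * (n + 1) + k) \<le> tree_cost p q (\<lambda>k. real (C (lev k))) r"
    unfolding b_def X2_def
  proof (rule Node.IH(2))
    show "spans r k s2" using sp k by simp
    show "card {x \<in> {k+1..k+s2}. lev x = j} \<le> m j" if "j \<in> {1..h}" for j
      using count'[OF that, of X2] X unfolding X2_def by blast
    show "lev x \<in> {1..h}" if "x \<in> {k+1..k+s2}" for x
      using lev that X unfolding X2_def by blast
  qed (use s k Node.prems(2) in simp)
  have "i + S c \<le> n" using codes Node.prems by simp
  then have "D (c * (n + 1) + i) \<le> cval D c i (lev k) a"
    using codes lev X cand c B_pos[of "lev k"] by (intro dp_ok_pos(5)[OF dp]) auto
  also have "\<dots> = real (C (lev k)) * (weight p q (Node l k r) + gap_weight q l + gap_weight q r)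
      + D (a * (n + 1) + i) + D (b * (n + 1) + k)"
    using codes s k a0 b0 weight_spans[OF Node.prems(1)] gap_weight_spans[OF sp(1)] gap_weight_spans[OF sp(2)]
    by (simp add: cval_def c)
  also have "\<dots> \<le> tree_cost p q (\<lambda>k. real (C (lev k))) (Node l k r)"
    using IH1 IH2 by simp
  finally show ?case unfolding c_def X_def .
qed

text \<open>Capacities do not occur: the sum of place values is what the recurrence adds up. That no
  level is overfull is recovered for the full code alone.\<close>

definition realizes :: "bst \<Rightarrow> (nat \<Rightarrow> nat) \<Rightarrow> nat \<Rightarrow> nat \<Rightarrow> real \<Rightarrow> bool" where
  "realizes T lev c i v \<longleftrightarrow> spans T i (S c) \<and> (\<Sum>k=i+1..i+S c. B (lev k)) = c \<and>
     (\<forall>k\<in>{i+1..i+S c}. lev k \<in> {1..h} \<and> 1 \<le> m (lev k)) \<and>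
     tree_cost p q (\<lambda>k. real (C (lev k))) T = v"

lemma realizes_Ext: "realizes (Ext i) lev 0 i 0"
  by (simp add: realizes_def)

lemma realizes_Node:
  assumes "cand c l a" "l \<in> {1..h}" "lev k = l" "k = i + S a + 1"
    and T1: "realizes T1 lev a i (D (a * (n + 1) + i))"
    and T2: "realizes T2 lev (c - (a + B l)) k (D ((c - (a + B l)) * (n + 1) + k))"
  shows "realizes (Node T1 k T2) lev c i (cval D c i l a)"
proof -
  define b where "b = c - (a + B l)"
  have c: "c = B l + (a + b)" and Sc: "S c = S a + S b + 1" and "1 \<le> m l"
    using assms(1) by (auto simp: cand_def b_def)
  have T2: "realizes T2 lev b k (D (b * (n + 1) + k))" using T2 unfolding b_def .
  have sp1: "spans T1 i (S a)" and sp2: "spans T2 k (S b)" using T1 T2 by (auto simp: realizes_def)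
  have sp: "spans (Node T1 k T2) i (S c)"
    using spans_NodeI[OF sp1] sp2 unfolding Sc assms(4) by simp
  have X: "{i+1..i+S c} = insert k ({i+1..i+S a} \<union> {k+1..k+S b})" unfolding Sc assms(4) by auto
  have "(\<Sum>k=i+1..i+S c. B (lev k)) = c"
    unfolding X using T1 T2 assms(3,4) by (subst sum.insert) (auto simp: sum.union_disjoint realizes_def c)
  moreover have "\<forall>k\<in>{i+1..i+S c}. lev k \<in> {1..h} \<and> 1 \<le> m (lev k)"
    unfolding X using T1 T2 assms(2,3) \<open>1 \<le> m l\<close> by (auto simp: realizes_def)
  moreover have zero: "x = 0 \<longleftrightarrow> S x = 0" if "realizes T lev x j v" for T x j v
  proof
    assume "S x = 0"
    then show "x = 0" using that unfolding realizes_def by force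
  qed simp
  have "gap_weight q T1 = (if a = 0 then q i else 0)"
    "gap_weight q T2 = (if b = 0 then q (i + S c) else 0)"
    using gap_weight_spans[OF sp1] gap_weight_spans[OF sp2] zero[OF T1] zero[OF T2] Sc assms(4) by auto
  then have "tree_cost p q (\<lambda>k. real (C (lev k))) (Node T1 k T2) = cval D c i l a"
    using T1 T2 weight_spans[OF sp] assms(3,4) by (simp add: cval_def realizes_def b_def[symmetric])
  ultimately show ?thesis using sp unfolding realizes_def by blast
qed

lemma realizes_cong:
  assumes "realizes T lev c i v" "\<And>k. k \<in> {i+1..i+S c} \<Longrightarrow> lev' k = lev k"
  shows "realizes T lev' c i v"
proof -
  have "tree_cost p q (\<lambda>k. real (C (lev' k))) T = tree_cost p q (\<lambda>k. real (C (lev k))) T"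
    using assms spans_set[of T i "S c"] by (intro tree_cost_cong) (auto simp: realizes_def)
  moreover have "(\<Sum>k=i+1..i+S c. B (lev' k)) = (\<Sum>k=i+1..i+S c. B (lev k))"
    using assms(2) by (intro sum.cong) auto
  ultimately show ?thesis using assms unfolding realizes_def by auto
qed

section \<open>From levels to addresses: level \<open>l\<close> is the block from
  \<open>off l + 1\<close> to \<open>off (Suc l)\<close>\<close>

definition off :: "nat \<Rightarrow> nat" where "off l = (\<Sum>k=1..<l. m k)"

lemma off_Suc: "0 < l \<Longrightarrow> off (Suc l) = off l + m l" and off_1 [simp]: "off (Suc 0) = 0"
  by (auto simp: off_def)

lemma off_mono: "l \<le> l' \<Longrightarrow> off l \<le> off l'"
  unfolding off_def by (intro sum_mono2) auto

lemma off_full: "off (Suc h) = n"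
  using sum_m by (simp add: off_def atLeastLessThanSuc_atLeastAtMost)

lemma level_unique:
  assumes "off l < a" "a \<le> off (Suc l)" "off l' < a" "a \<le> off (Suc l')"
  shows "l = l'"
  using off_mono[of "Suc l" l'] off_mono[of "Suc l'" l] assms by (cases l l' rule: linorder_cases) auto

lemma access_cost_level:
  assumes "l \<in> {1..h}" "off l < a" "a \<le> off (Suc l)"
  shows "access_cost I a = C l"
proof -
  have off: "(\<Sum>k=1..<l. m k) = off l" "(\<Sum>k=1..l. m k) = off (Suc l)" for l
    by (simp_all add: off_def atLeastLessThanSuc_atLeastAtMost)
  have "(THE l. l \<in> {1..h} \<and> off l < a \<and> a \<le> off (Suc l)) = l"
    using assms level_unique by (intro the_equality) blast+
  then show ?thesis unfolding access_cost_def off by simp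
qed

lemma level_exists:
  assumes "a \<in> {1..n}"
  obtains l where "l \<in> {1..h}" "off l < a" "a \<le> off (Suc l)"
proof -
  define l where "l = (LEAST l. a \<le> off (Suc l))"
  have "a \<le> off (Suc l)" "l \<le> h" unfolding l_def
    using LeastI[of "\<lambda>l. a \<le> off (Suc l)" h] Least_le[of "\<lambda>l. a \<le> off (Suc l)" h] assms off_full by auto
  moreover have "l \<noteq> 0" using calculation assms by (cases l) auto
  moreover have "off l < a"
    using not_less_Least[of "l - 1" "\<lambda>l. a \<le> off (Suc l)"] \<open>l \<noteq> 0\<close> by (simp add: l_def[symmetric])
  ultimately show thesis by (intro that[of l]) auto
qed

lemma cost_eq_tree_cost:
  assumes "is_bst n T"
  shows "cost I T \<phi> = tree_cost p q (\<lambda>k. real (access_cost I (\<phi> k))) T"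
proof -
  let ?g = "\<lambda>k. real (access_cost I (\<phi> k))"
  have T: "set (int_labels T) = {1..n}" "set (ext_labels T) = {0..n}"
    "distinct (int_labels T)" "distinct (ext_labels T)" "int_labels T \<noteq> []"
    using assms n_pos by (auto simp: is_bst_def simp del: upt_Suc)
  have "cost I T \<phi> = key_cost p q ?g T + gap_cost p q ?g T"
    by (simp add: cost_def key_cost_def gap_cost_def T(1,2))
  also have "\<dots> = tree_cost p q ?g T"
    using T by (intro tree_cost_eq) auto
  finally show ?thesis .
qed

lemma is_bst_spans: "is_bst n T \<longleftrightarrow> spans T 0 n"
  by (simp add: is_bst_def spans_def)

text \<open>Within a level the keys receive consecutive addresses in key order, which fits because
  level \<open>l\<close> occurs exactly \<open>m l\<close> times. Conversely, any solution induces
  levels; injectivity bounds their counts by \<open>m\<close>, the total \<open>n\<close> turns the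
  bounds into equalities, so its code is \<open>N - 1\<close> as well and the lower bound
  applies.\<close>

lemma optimumI:
  assumes dp: "\<And>c i. c < N \<Longrightarrow> i + S c \<le> n \<Longrightarrow> dp_ok D L A c i"
    and T: "realizes T lev (N - 1) 0 (D ((N - 1) * (n + 1)))"
    and \<phi>: "\<And>k. k \<in> {1..n} \<Longrightarrow> \<phi> k = off (lev k) + card {k' \<in> {1..k}. lev k' = lev k}"
  shows "optimum I T \<phi>"
proof -
  have bst: "is_bst n T" using T S_full by (simp add: realizes_def is_bst_spans)
  have lev: "lev k \<in> {1..h} \<and> 1 \<le> m (lev k)" if "k \<in> {1..n}" for k
    using T that S_full by (simp add: realizes_def)
  have count: "card {k \<in> {1..n}. lev k = l} = m l" if "l \<in> {1..h}" for l
    using T lev that S_full by (intro levels_of_full_code) (simp_all add: realizes_def)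
  have block: "off (lev k) < \<phi> k \<and> \<phi> k \<le> off (Suc (lev k))" if k: "k \<in> {1..n}" for k
  proof -
    have "card {k' \<in> {1..k}. lev k' = lev k} \<le> card {k' \<in> {1..n}. lev k' = lev k}"
      using k by (intro card_mono) auto
    moreover have "0 < card {k' \<in> {1..k}. lev k' = lev k}" using k by (auto simp: card_gt_0_iff)
    ultimately show ?thesis using lev[OF k] count by (simp add: \<phi>[OF k] off_Suc)
  qed
  have "inj_on \<phi> {1..n}"
  proof (rule linorder_inj_onI')
    fix k k' assume k: "k \<in> {1..n}" "k' \<in> {1..n}" "k < k'"
    show "\<phi> k \<noteq> \<phi> k'"
    proof
      assume eq: "\<phi> k = \<phi> k'"
      then have "lev k = lev k'" using level_unique block k by metis
      have "{j \<in> {1..k}. lev j = lev k} \<subseteq> {j \<in> {1..k'}. lev j = lev k'}"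
        "k' \<in> {j \<in> {1..k'}. lev j = lev k'}" "k' \<notin> {j \<in> {1..k}. lev j = lev k}"
        using k \<open>lev k = lev k'\<close> by auto
      then have "card {j \<in> {1..k}. lev j = lev k} < card {j \<in> {1..k'}. lev j = lev k'}"
        by (intro psubset_card_mono) auto
      then show False using eq \<phi>[OF k(1)] \<phi>[OF k(2)] \<open>lev k = lev k'\<close> by simp
    qed
  qed
  moreover have "\<phi> \<in> {1..n} \<rightarrow> {1..n}"
  proof
    fix k assume k: "k \<in> {1..n}"
    have "off (Suc (lev k)) \<le> off (Suc h)" using lev[OF k] by (intro off_mono) simp
    then show "\<phi> k \<in> {1..n}" using block[OF k] off_full by simp
  qed
  ultimately have sol: "is_solution I T \<phi>" using bst by (simp add: is_solution_def)
  have "tree_cost p q (\<lambda>k. real (access_cost I (\<phi> k))) T = tree_cost p q (\<lambda>k. real (C (lev k))) T"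
  proof (rule tree_cost_cong)
    fix k assume "k \<in> set (int_labels T)"
    then have "k \<in> {1..n}" using bst by (auto simp: is_bst_def)
    then show "real (access_cost I (\<phi> k)) = real (C (lev k))"
      using access_cost_level block lev by simp
  qed
  then have cost: "cost I T \<phi> = D ((N - 1) * (n + 1))"
    using T by (simp add: cost_eq_tree_cost[OF bst] realizes_def)
  have "cost I T \<phi> \<le> cost I T' \<phi>'" if sol': "is_solution I T' \<phi>'" for T' \<phi>'
  proof -
    have bst': "is_bst n T'" and \<phi>': "\<phi>' \<in> {1..n} \<rightarrow> {1..n}" "inj_on \<phi>' {1..n}"
      using sol' by (auto simp: is_solution_def)
    have "\<forall>k\<in>{1..n}. \<exists>l. l \<in> {1..h} \<and> off l < \<phi>' k \<and> \<phi>' k \<le> off (Suc l)"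
      using level_exists \<phi>'(1) by (metis Pi_mem)
    then obtain lev' where lev': "\<And>k. k \<in> {1..n} \<Longrightarrow>
        lev' k \<in> {1..h} \<and> off (lev' k) < \<phi>' k \<and> \<phi>' k \<le> off (Suc (lev' k))" by metis
    have le: "card {k \<in> {1..n}. lev' k = l} \<le> m l" if "l \<in> {1..h}" for l
    proof -
      have "card {k \<in> {1..n}. lev' k = l} \<le> card {off l<..off (Suc l)}"
        using lev' by (intro card_inj_on_le[of \<phi>'] inj_on_subset[OF \<phi>'(2)]) auto
      then show ?thesis using that by (simp add: off_Suc)
    qed
    have "(\<Sum>l=1..h. card {k \<in> {1..n}. lev' k = l}) = sum m {1..h}"
      using sum_levels[of "{1..n}" lev' "\<lambda>_. 1"] lev' sum_m by simp
    then have eq: "card {k \<in> {1..n}. lev' k = l} = m l" if "l \<in> {1..h}" for l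
      using sum_mono_inv[of "\<lambda>l. card {k \<in> {1..n}. lev' k = l}" "{1..h}" m] le that by blast
    have "(\<Sum>k=1..n. B (lev' k)) = N - 1"
      using sum_levels[of "{1..n}" lev' B] lev' eq full_code by simp
    moreover have "D ((\<Sum>k=0+1..0+n. B (lev' k)) * (n + 1) + 0)
        \<le> tree_cost p q (\<lambda>k. real (C (lev' k))) T'"
      by (rule dp_lower_bound[OF dp]) (use bst' lev' le in \<open>auto simp: is_bst_spans\<close>)
    moreover have "tree_cost p q (\<lambda>k. real (access_cost I (\<phi>' k))) T' = tree_cost p q (\<lambda>k. real (C (lev' k))) T'"
    proof (rule tree_cost_cong)
      fix k assume "k \<in> set (int_labels T')"
      then have "k \<in> {1..n}" using bst' by (auto simp: is_bst_def)
      then show "real (access_cost I (\<phi>' k)) = real (C (lev' k))"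
        using access_cost_level lev' by simp
    qed
    ultimately show ?thesis using cost by (simp add: cost_eq_tree_cost[OF bst'])
  qed
  then show ?thesis using sol by (simp add: optimum_def)
qed

section \<open>The number of candidate evaluations against the claimed bound\<close>

lemma N_bound:
  "real (N * N * h * n) \<le> 4 * (2 ^ (h - 1) / fact (h - 1) * real n ^ (2 * h + 1))"
proof -
  have h: "1 \<le> h" "h \<le> n" using h_pos h_le_n .
  have sum: "(\<Sum>l=1..h. real (m l + 1)) = real (n + h)"
    using sum_m by (simp add: sum.distrib flip: of_nat_sum)
  have "real N = (\<Prod>l=1..h. real (m l + 1))"
    unfolding N_def radix_def by (simp add: atLeastLessThanSuc_atLeastAtMost)
  also have "\<dots> \<le> (real (n + h) / real h) ^ h"
    using prod_le_mean_power[of "{1..h}" "\<lambda>l. real (m l + 1)"] h unfolding sum by simp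
  \<comment> \<open>Here \<open>h \<le> n\<close> enters, through
    \<open>n + h \<le> 2 * n\<close>.\<close>
  also have "\<dots> \<le> (2 * real n / real h) ^ h"
    using h by (intro power_mono divide_right_mono) auto
  finally have "real N * real h ^ h \<le> (2 * real n) ^ h"
    using h by (simp add: power_divide field_simps)
  then have "(real N * real h ^ h)\<^sup>2 \<le> ((2 * real n) ^ h)\<^sup>2"
    by (intro power_mono) auto
  also have "\<dots> = 2 ^ h * 2 ^ h * real n ^ (2 * h)"
    unfolding power_mult_distrib power2_eq_square mult_2[of h] power_add by (simp only: mult_ac)
  finally have 1: "real N ^ 2 * (real h ^ h * real h ^ h) \<le> 2 ^ h * 2 ^ h * real n ^ (2 * h)"
    by (simp only: power_mult_distrib power2_eq_square mult_ac)
  have 2: "(2::real) ^ h \<le> 2 * real h ^ h"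
    using of_nat_mono[OF two_power_le_self_power[OF h(1)], where 'a = real] by simp
  have "(fact h :: real) \<le> real (h ^ h)" by (rule fact_le_power)
  moreover have "(fact h :: real) = real h * fact (h - 1)" using h by (simp add: fact_reduce)
  ultimately have 3: "real h * fact (h - 1) \<le> real h ^ h" by simp
  have pos: "0 < real h ^ h" using h by simp
  \<comment> \<open>Of the two factors \<open>h ^ h\<close>, one dominates
    \<open>h * fact (h - 1) = fact h\<close>, the other one of the factors \<open>2 ^ h\<close> up
    to 2. What remains is \<open>2 * 2 ^ h = 4 * 2 ^ (h - 1)\<close>, the origin of the constant
    4.\<close>
  have "real N ^ 2 * (real h * fact (h - 1)) * real h ^ h \<le> real N ^ 2 * (real h ^ h * real h ^ h)"
    using 3 pos by (simp add: mult_left_mono mult.assoc)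
  also have "\<dots> \<le> 2 ^ h * 2 ^ h * real n ^ (2 * h)" by (rule 1)
  also have "\<dots> \<le> (2 * real h ^ h) * 2 ^ h * real n ^ (2 * h)"
    using 2 by (intro mult_right_mono) auto
  finally have "real N ^ 2 * (real h * fact (h - 1)) \<le> 2 * 2 ^ h * real n ^ (2 * h)"
    using pos by (simp add: mult_ac)
  moreover have "(2::real) ^ h = 2 * 2 ^ (h - 1)" using h by (cases h) auto
  ultimately have "real N ^ 2 * real h \<le> 4 * (2 ^ (h - 1) / fact (h - 1) * real n ^ (2 * h))"
    by (simp add: field_simps)
  then have "real N ^ 2 * real h * real n \<le> 4 * (2 ^ (h - 1) / fact (h - 1) * real n ^ (2 * h)) * real n"
    by (rule mult_right_mono) simp
  then show ?thesis by (simp add: power2_eq_square mult_ac)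
qed

end

section \<open>Tables\<close>

lemma runs_SeqI:
  assumes "runs c s t1 M" "\<And>s'. M s' \<Longrightarrow> runs d s' t2 Q" "t1 + t2 \<le> t"
  shows "runs (c ;; d) s t Q"
  by (rule runs_Seq[OF runs_conseq[OF assms(1) order_refl assms(2)] assms(3)])

text \<open>
  Natural registers 2 to 18 are constants once set: 2, 3, 4 hold 0, 1, 8; 5, 6, 7 hold \<open>n\<close>, \<open>h\<close>,
  \<open>n + 1\<close>; 15, 16, 17 hold \<open>N\<close> (only \<open>B\<^sub>l\<close> while level \<open>l\<close> is prepared), \<open>N (n + 1)\<close>, \<open>h N\<close>; 18
  holds the start \<open>2 n + 2\<close> of the prefix sums in real memory. The tables in natural memory are
  interleaved with stride 8 above the input and output cells, and 8 to 14 hold their starts: \<open>B\<close>, the next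
  free address of each level, \<open>S\<close>, the level and the left code chosen for each subproblem, and the two components
  of the stack. Register 8 is also the start of the table of optimum costs in real memory.
\<close>

abbreviation ld :: "nat \<Rightarrow> nat \<Rightarrow> nat \<Rightarrow> instr list" where
  "ld d i g \<equiv> [NArith Times 20 i 4, NArith Plus 20 20 g, NLoad d 20]"
abbreviation st :: "nat \<Rightarrow> nat \<Rightarrow> nat \<Rightarrow> instr list" where
  "st i g v \<equiv> [NArith Times 20 i 4, NArith Plus 20 20 g, NStore 20 v]"
abbreviation rld :: "nat \<Rightarrow> nat \<Rightarrow> nat \<Rightarrow> instr list" where
  "rld d b i \<equiv> [NArith Plus 20 b i, RLoad d 20]"
abbreviation rst :: "nat \<Rightarrow> nat \<Rightarrow> nat \<Rightarrow> instr list" where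
  "rst b i v \<equiv> [NArith Plus 20 b i, RStore 20 v]"

definition setup_block :: com where
  "setup_block = Blk [NConst 3 1, NConst 4 8, NLoad 5 2, NLoad 6 3, NArith Plus 7 5 3,
     NConst 20 3, NArith Times 8 20 7, NArith Plus 9 8 3, NArith Plus 9 9 3, NArith Plus 10 9 3,
     NArith Plus 11 10 3, NArith Plus 12 11 3, NArith Plus 13 12 3, NArith Plus 14 13 3,
     NArith Plus 18 7 7, NConst 15 1, NConst 21 1, NConst 22 1, NArith Plus 23 6 3]"

text \<open>Fills \<open>S c\<close> for codes with leading level \<open>l\<close> from
  \<open>S (c - B l)\<close>, an entry of smaller index that is already present.\<close>

definition digit_body :: com where
  "digit_body = Blk ([NArith Minus 26 25 15] @ ld 26 26 10 @ [NArith Plus 26 26 3] @ st 25 10 26 @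
     [NArith Plus 25 25 3])"

text \<open>Adding register 2, which holds 0, serves as a move. Register 22 runs through the first
  addresses of the levels, register 15 through the place values.\<close>

definition level_body :: com where
  "level_body =
     Blk (st 21 8 15 @ st 21 9 22 @ [NArith Plus 20 21 3, NLoad 24 20, NArith Plus 22 22 24,
       NArith Plus 24 24 3, NArith Times 24 15 24, NArith Plus 25 15 2]) ;;
     While 25 24 digit_body ;;
     Blk [NArith Plus 15 24 2, NArith Plus 21 21 3]"

definition prefix_body :: com where
  "prefix_body = Blk ([RLoad 3 21, RArith Plus 2 2 3] @ rld 3 7 21 @ [RArith Plus 2 2 3] @
     rst 18 21 2 @ [NArith Plus 21 21 3])"

definition prep :: com where
  "prep = setup_block ;; While 21 23 level_body ;;
     Blk [RLoad 2 7, RStore 18 2, NConst 21 1] ;; While 21 7 prefix_body"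

section \<open>Memory layout and correctness of the preparation\<close>

context hmm begin

text \<open>The tables start above the output cells, which end at \<open>3 * n + 2\<close>, and by
  \<open>h \<le> n\<close> also above the input. In real memory the same address follows the prefix
  sums, which occupy \<open>2 * n + 2\<close> to \<open>3 * n + 2\<close>.\<close>

definition tg :: "nat \<Rightarrow> nat" where "tg g = 3 * n + 3 + g"
text \<open>Tables are told apart by the residue of the address modulo 8, so disjointness needs no
  bound on their lengths.\<close>

definition adr :: "nat \<Rightarrow> nat \<Rightarrow> nat" where "adr g i = i * 8 + tg g"

lemma adr_fold [simp]: "i * 8 + tg g = adr g i"
  by (simp add: adr_def)

lemma adr_eq [simp]: "g < 8 \<Longrightarrow> g' < 8 \<Longrightarrow> adr g i = adr g' i' \<longleftrightarrow> g = g' \<and> i = i'"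
  by (auto simp: adr_def tg_def) presburger+

lemma adr_neq [simp]: "x < 3 * n + 3 \<Longrightarrow> adr g i \<noteq> x" "x < 3 * n + 3 \<Longrightarrow> x \<noteq> adr g i"
  by (auto simp: adr_def tg_def)

definition regs :: "(nat \<Rightarrow> nat) \<Rightarrow> bool" where
  "regs r \<longleftrightarrow> r 2 = 0 \<and> r 3 = 1 \<and> r 4 = 8 \<and> r 5 = n \<and> r 6 = h \<and> r 7 = n + 1 \<and>
     r 8 = tg 0 \<and> r 9 = tg 2 \<and> r 10 = tg 3 \<and> r 11 = tg 4 \<and> r 12 = tg 5 \<and> r 13 = tg 6 \<and>
     r 14 = tg 7 \<and> r 18 = 2 * n + 2"

definition inp :: "(nat \<Rightarrow> nat) \<Rightarrow> bool" where
  "inp M \<longleftrightarrow> (\<forall>l\<in>{1..h}. M (l + 1) = m l \<and> M (h + l + 1) = C l)"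

definition rinp :: "(nat \<Rightarrow> real) \<Rightarrow> bool" where
  "rinp R \<longleftrightarrow> (\<forall>k\<in>{1..n}. R k = p k) \<and> (\<forall>j\<le>n. R (n + 1 + j) = q j)"

definition tabB :: "nat \<Rightarrow> (nat \<Rightarrow> nat) \<Rightarrow> bool" where
  "tabB j M \<longleftrightarrow> (\<forall>l\<in>{1..<j}. M (adr 0 l) = B l \<and> M (adr 2 l) = off l + 1)"

definition tabS :: "nat \<Rightarrow> (nat \<Rightarrow> nat) \<Rightarrow> bool" where
  "tabS c M \<longleftrightarrow> (\<forall>x<c. M (adr 3 x) = S x)"

definition tabP :: "nat \<Rightarrow> (nat \<Rightarrow> real) \<Rightarrow> bool" where
  "tabP j R \<longleftrightarrow> (\<forall>k<j. R (2 * n + 2 + k) = PS k)"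

lemmas tabs = regs_def inp_def rinp_def tabB_def tabS_def tabP_def

lemma regs_upd [simp]: "14 < x \<Longrightarrow> x \<noteq> 18 \<Longrightarrow> regs (r(x := v)) = regs r"
  by (simp add: regs_def)

lemma inp_upd [simp]: "inp (M(adr g i := v)) = inp M"
  using h_le_n by (auto simp: inp_def)

lemma rinp_upd [simp]: "2 * n + 2 \<le> a \<Longrightarrow> rinp (R(a := v)) = rinp R"
  by (auto simp: rinp_def)

lemma tabB_upd [simp]: "g \<noteq> 0 \<Longrightarrow> g \<noteq> 2 \<Longrightarrow> g < 8 \<Longrightarrow> tabB j (M(adr g i := v)) = tabB j M"
  by (simp add: tabB_def)

lemma tabS_upd [simp]: "g \<noteq> 3 \<Longrightarrow> g < 8 \<Longrightarrow> tabS c (M(adr g i := v)) = tabS c M"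
  by (simp add: tabS_def)

lemma tabB_Suc: "tabB l M \<Longrightarrow> tabB (Suc l) (M(adr 0 l := B l, adr 2 l := Suc (off l)))"
  by (auto simp: tabB_def less_Suc_eq)

lemma tabS_Suc: "tabS c M \<Longrightarrow> tabS (Suc c) (M(adr 3 c := S c))"
  by (auto simp: tabS_def less_Suc_eq)

lemma tabP_Suc: "tabP k R \<Longrightarrow> tabP (Suc k) (R(2 * n + 2 + k := PS k))"
  by (auto simp: tabP_def less_Suc_eq)

lemma rinp_q: "rinp R \<Longrightarrow> j \<le> n \<Longrightarrow> R (Suc (n + j)) = q j"
  and rinp_p: "rinp R \<Longrightarrow> 1 \<le> j \<Longrightarrow> j \<le> n \<Longrightarrow> R j = p j"
  and tabP_D: "tabP j R \<Longrightarrow> k < j \<Longrightarrow> R (Suc (Suc (2 * n + k))) = PS k"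
  and inp_m: "inp M \<Longrightarrow> 1 \<le> l \<Longrightarrow> l \<le> h \<Longrightarrow> M (Suc l) = m l"
  and inp_C: "inp M \<Longrightarrow> 1 \<le> l \<Longrightarrow> l \<le> h \<Longrightarrow> M (Suc (h + l)) = C l"
  and tabB_D: "tabB j M \<Longrightarrow> 1 \<le> l \<Longrightarrow> l < j \<Longrightarrow> M (adr 0 l) = B l"
  and tabS_D: "tabS c M \<Longrightarrow> x < c \<Longrightarrow> M (adr 3 x) = S x"
  by (auto simp: tabs)

text \<open>The codes below \<open>B l\<close> are those built from the levels below
  \<open>l\<close>, so exactly their digit sums are known before level \<open>l\<close> is
  treated.\<close>

definition level_inv :: "nat \<Rightarrow> ram_state \<Rightarrow> bool" where
  "level_inv l s \<longleftrightarrow> regs (nreg s) \<and> inp (nmem s) \<and> rinp (rmem s) \<and> 1 \<le> l \<and> nreg s 21 = l \<and>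
     nreg s 23 = Suc h \<and> nreg s 15 = B l \<and> nreg s 22 = Suc (off l) \<and>
     tabB l (nmem s) \<and> tabS (B l) (nmem s)"

definition digit_inv :: "nat \<Rightarrow> nat \<Rightarrow> ram_state \<Rightarrow> bool" where
  "digit_inv l c s \<longleftrightarrow> regs (nreg s) \<and> inp (nmem s) \<and> rinp (rmem s) \<and> nreg s 21 = l \<and>
     nreg s 23 = Suc h \<and> nreg s 15 = B l \<and> nreg s 22 = Suc (off (Suc l)) \<and> tabB (Suc l) (nmem s) \<and>
     nreg s 24 = B (Suc l) \<and> nreg s 25 = c \<and> B l \<le> c \<and> tabS c (nmem s)"

lemma setup_block: "runs setup_block (input_state I) 19 (level_inv 1)"
  unfolding setup_block_def
proof (rule runs_Blk)
  \<comment> \<open>The entry for \<open>S 0 = 0\<close> is already in place, because memory above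
    the input is initially zero.\<close>
  show "level_inv 1 (fold effect [NConst 3 1, NConst 4 8, NLoad 5 2, NLoad 6 3, NArith Plus 7 5 3,
     NConst 20 3, NArith Times 8 20 7, NArith Plus 9 8 3, NArith Plus 9 9 3, NArith Plus 10 9 3,
     NArith Plus 11 10 3, NArith Plus 12 11 3, NArith Plus 13 12 3, NArith Plus 14 13 3,
     NArith Plus 18 7 7, NConst 15 1, NConst 21 1, NConst 22 1, NArith Plus 23 6 3] (input_state I))"
    using h_pos h_le_n by (auto simp: level_inv_def tabs tg_def input_state_def Let_def adr_def)
qed auto

lemma digit_body:
  assumes "1 \<le> l" "l \<le> h" "c < B (Suc l)" "digit_inv l c s"
  shows "runs digit_body s 9 (digit_inv l (Suc c))"
  unfolding digit_body_def
proof (rule runs_Blk)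
  have "B l \<le> c" using assms(4) by (simp add: digit_inv_def)
  then have "S c = Suc (S (c - B l))" "c - B l < c"
    using assms S_step[of l c] B_pos[of l] by (simp, linarith)
  moreover from this have "nmem s (adr 3 (c - B l)) = S (c - B l)"
    using assms(4) tabS_D unfolding digit_inv_def by blast
  ultimately show "digit_inv l (Suc c) (fold effect ([NArith Minus 26 25 15] @ ld 26 26 10 @
     [NArith Plus 26 26 3] @ st 25 10 26 @ [NArith Plus 25 25 3]) s)"
    using assms(4) tabS_Suc[of c "nmem s"] by (simp add: digit_inv_def) (simp add: regs_def)
qed auto

lemma level_body:
  assumes "l < Suc h" "level_inv l s"
  shows "runs level_body s (N * 11 + 15) (level_inv (Suc l))"
  unfolding level_body_def
proof (rule runs_SeqI)
  have l: "1 \<le> l" "l \<le> h" using assms by (auto simp: level_inv_def)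
  then have "nmem s (Suc l) = m l" "Suc l < 3 * n + 3"
    using assms(2) h_le_n inp_m by (auto simp: level_inv_def)
  then show "runs (Blk (st 21 8 15 @ st 21 9 22 @ [NArith Plus 20 21 3, NLoad 24 20, NArith Plus 22 22 24,
       NArith Plus 24 24 3, NArith Times 24 15 24, NArith Plus 25 15 2])) s 12 (digit_inv l (B l))"
    using assms(2) tabB_Suc[of l "nmem s"] l
    by (intro runs_Blk) (simp_all add: level_inv_def digit_inv_def off_Suc B_Suc regs_def)
next
  fix s assume inv: "digit_inv l (B l) s"
  have "1 \<le> l" "l \<le> h" using assms by (auto simp: level_inv_def)
  \<comment> \<open>A crude count suffices: every level is charged for all \<open>N\<close>
    codes.\<close>
  have "B (Suc l) \<le> N" using assms(1) unfolding N_eq B_def by (intro radix_mono) simp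
  then have "(B (Suc l) - B l) * 11 \<le> N * 11" by simp
  show "runs (While 25 24 digit_body ;; Blk [NArith Plus 15 24 2, NArith Plus 21 21 3])
       s (N * 11 + 3) (level_inv (Suc l))"
  proof (rule runs_SeqI[where M = "digit_inv l (B (Suc l))"])
    show "runs (While 25 24 digit_body) s (N * 11 + 1) (digit_inv l (B (Suc l)))"
    proof (rule runs_for[where Inv = "digit_inv l" and lo = "B l"])
      show "runs digit_body s' 9 (digit_inv l (Suc c))" if "c < B (Suc l)" "digit_inv l c s'" for c s'
        by (rule digit_body[OF \<open>1 \<le> l\<close> \<open>l \<le> h\<close> that])
      show "nreg s' 25 = c \<and> nreg s' 24 = B (Suc l)" if "digit_inv l c s'" for c s'
        using that by (simp add: digit_inv_def)
      show "B l \<le> B (Suc l)" using \<open>1 \<le> l\<close> by (simp add: B_Suc)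
      show "(B (Suc l) - B l) * (9 + 2) + 1 \<le> N * 11 + 1"
        using \<open>(B (Suc l) - B l) * 11 \<le> N * 11\<close> by simp
    qed (rule inv)
    show "runs (Blk [NArith Plus 15 24 2, NArith Plus 21 21 3]) s' 2 (level_inv (Suc l))"
      if "digit_inv l (B (Suc l)) s'" for s'
      using that by (intro runs_Blk) (simp_all add: level_inv_def digit_inv_def regs_def)
  qed simp
qed simp

definition static :: "ram_state \<Rightarrow> bool" where
  "static s \<longleftrightarrow> regs (nreg s) \<and> inp (nmem s) \<and> rinp (rmem s) \<and> nreg s 15 = N \<and>
     tabB (Suc h) (nmem s) \<and> tabS N (nmem s) \<and> tabP (Suc n) (rmem s)"

definition prefix_inv :: "nat \<Rightarrow> ram_state \<Rightarrow> bool" where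
  "prefix_inv k s \<longleftrightarrow> regs (nreg s) \<and> inp (nmem s) \<and> rinp (rmem s) \<and> nreg s 15 = N \<and>
     tabB (Suc h) (nmem s) \<and> tabS N (nmem s) \<and>
     1 \<le> k \<and> nreg s 21 = k \<and> rreg s 2 = PS (k - 1) \<and> tabP k (rmem s)"

lemma prefix_body:
  assumes "k < Suc n" "prefix_inv k s"
  shows "runs prefix_body s 8 (prefix_inv (Suc k))"
  unfolding prefix_body_def
proof (rule runs_Blk)
  have "1 \<le> k" using assms(2) by (simp add: prefix_inv_def)
  then have "PS k = PS (k - 1) + p k + q k" by (cases k) (auto simp: PS_def)
  moreover have "rmem s k = p k" "rmem s (Suc (n + k)) = q k"
    using assms by (auto simp: prefix_inv_def rinp_p rinp_q)
  ultimately show "prefix_inv (Suc k) (fold effect ([RLoad 3 21, RArith Plus 2 2 3] @ rld 3 7 21 @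
      [RArith Plus 2 2 3] @ rst 18 21 2 @ [NArith Plus 21 21 3]) s)"
    using assms tabP_Suc[of k "rmem s"] by (simp add: prefix_inv_def regs_def)
qed auto

lemma prep:
  "runs prep (input_state I) (19 + (h * (N * 11 + 17) + 1 + (3 + (n * 10 + 1)))) static"
  unfolding prep_def
proof (rule runs_SeqI[OF setup_block])
  fix s assume inv1: "level_inv 1 s"
  show "runs (While 21 23 level_body ;; Blk [RLoad 2 7, RStore 18 2, NConst 21 1] ;; While 21 7 prefix_body)
     s (h * (N * 11 + 17) + 1 + (3 + (n * 10 + 1))) static"
  proof (rule runs_SeqI[where M = "level_inv (Suc h)"])
    show "runs (While 21 23 level_body) s (h * (N * 11 + 17) + 1) (level_inv (Suc h))"
      by (rule runs_for[where Inv = level_inv and lo = 1, OF level_body])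
        (use inv1 in \<open>auto simp: level_inv_def\<close>)
  next
    fix s assume inv: "level_inv (Suc h) s"
    show "runs (Blk [RLoad 2 7, RStore 18 2, NConst 21 1] ;; While 21 7 prefix_body) s (3 + (n * 10 + 1)) static"
    proof (rule runs_SeqI[where M = "prefix_inv 1"])
      have "rmem s (Suc n) = q 0" using inv rinp_q[of "rmem s" 0] by (simp add: level_inv_def)
      then show "runs (Blk [RLoad 2 7, RStore 18 2, NConst 21 1]) s 3 (prefix_inv 1)"
        using inv by (intro runs_Blk)
          (simp_all add: level_inv_def prefix_inv_def regs_def PS_def N_eq tabP_def)
      show "runs (While 21 7 prefix_body) s' (n * 10 + 1) static" if "prefix_inv 1 s'" for s'
        by (rule runs_for[where Inv = prefix_inv and lo = 1, OF prefix_body])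
          (use that in \<open>auto simp: prefix_inv_def static_def regs_def\<close>)
    qed simp
  qed simp
qed simp

end

lemma runs_BlkI:
  "(\<And>s'. s' = fold effect ins s \<Longrightarrow> Q s') \<Longrightarrow> list_all straight ins \<Longrightarrow> length ins \<le> t \<Longrightarrow> runs (Blk ins) s t Q"
  by (rule runs_Blk) auto

section \<open>The main loop\<close>

text \<open>Register 28 enumerates the pairs \<open>(l, a)\<close> as
  \<open>(l - 1) * N + a\<close>. Even when \<open>a + B l\<close> exceeds \<open>c\<close>,
  truncation keeps the index of the right code inside the table, so the validity of the pair can be
  decided afterwards, in register 38.\<close>

definition cand_head :: "instr list" where
  "cand_head = [NArith Divide 29 28 15, NArith Times 20 29 15, NArith Minus 30 28 20,
       NArith Plus 29 29 3, NArith Plus 20 29 3, NLoad 31 20] @ ld 32 29 8 @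
     [NArith Plus 33 30 32, NArith Minus 34 22 33] @ ld 35 30 10 @ ld 36 34 10 @
     [NArith Plus 37 35 36, NArith Plus 37 37 3, NArith Minus 38 37 24, NArith Minus 39 24 37,
       NArith Plus 38 38 39, NArith Minus 39 33 22, NArith Plus 38 38 39, NArith Minus 39 3 31,
       NArith Plus 38 38 39]"

definition cand_root :: "instr list" where
  "cand_root = [NArith Plus 20 6 29, NArith Plus 20 20 3, NLoad 39 20, RofN 8 39, RofN 9 2,
     RArith Plus 9 5 9]"

definition cand_children :: "instr list" where
  "cand_children = [RArith Times 8 8 9, NArith Times 20 30 7, NArith Plus 20 20 23] @ rld 10 8 20 @
     [RArith Plus 8 8 10, NArith Times 20 34 7, NArith Plus 36 23 35, NArith Plus 36 36 3,
      NArith Plus 20 20 36] @ rld 10 8 20 @ [RArith Plus 8 8 10]"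

text \<open>The difference of real register 8 with itself is the zero needed for a move into
  register 7.\<close>

definition take_cand :: "instr list" where
  "take_cand = [RArith Minus 10 8 8, RArith Plus 7 8 10, NArith Plus 26 29 2, NArith Plus 27 30 2]"

definition cand_eval :: com where
  "cand_eval =
     Blk cand_root ;;
     If 30 2 (Blk [RArith Plus 9 9 3]) (Blk []) ;;
     If 34 2 (Blk [RArith Plus 9 9 4]) (Blk []) ;;
     Blk cand_children ;;
     If 26 2 (Blk take_cand) (IfR 7 8 (Blk []) (Blk take_cand))"

definition cand_body :: com where
  "cand_body = Blk cand_head ;; If 38 2 cand_eval (Blk []) ;; Blk [NArith Plus 28 28 3]"

definition cell_head :: "instr list" where
  "cell_head = [NArith Divide 22 21 7, NArith Times 20 22 7, NArith Minus 23 21 20] @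
     ld 24 22 10 @ [NArith Plus 25 23 24] @ rld 3 7 23 @ rld 4 7 25 @ rld 5 18 25 @ rld 6 18 23 @
     [RArith Minus 5 5 6, RArith Plus 5 5 3, NConst 26 0, NConst 27 0, RofN 7 2, NConst 28 0]"

definition cell_tail :: "instr list" where
  "cell_tail = rst 8 21 7 @ st 21 11 26 @ st 21 12 27 @ [NArith Plus 21 21 3]"

definition cell_body :: com where
  "cell_body = Blk cell_head ;; While 28 17 cand_body ;; Blk cell_tail"

text \<open>Cells are filled by increasing number, hence by increasing code; both children of a
  candidate have smaller codes because place values are positive.\<close>

definition solve :: com where
  "solve = Blk [NArith Times 16 15 7, NArith Times 17 6 15, NConst 21 0] ;; While 21 16 cell_body"

section \<open>Correctness of the dynamic program\<close>

context hmm begin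

definition dp_addr :: "nat \<Rightarrow> nat" where "dp_addr y = tg 0 + y"

lemma dp_addr_eq [simp]: "dp_addr x = dp_addr y \<longleftrightarrow> x = y"
  by (simp add: dp_addr_def)

lemma rinp_dp_addr [simp]: "rinp (R(dp_addr y := v)) = rinp R"
  by (auto simp: rinp_def dp_addr_def tg_def)

lemma tabP_dp_addr [simp]: "tabP (Suc n) (R(dp_addr y := v)) = tabP (Suc n) R"
  by (auto simp: tabP_def dp_addr_def tg_def)

lemma dp_addr_fold [simp]: "tg 0 + y = dp_addr y"
  by (simp only: dp_addr_def)

text \<open>A truncated difference \<open>x - y\<close> vanishes iff \<open>x \<le> y\<close>, and
  the two opposite differences together express equality; so one number and one comparison decide
  the whole conjunction.\<close>

lemma cand_iff:
  "S a + S (c - (a + B l)) + 1 - S c + (S c - (S a + S (c - (a + B l)) + 1)) + (a + B l - c) + (1 - m l) = 0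
    \<longleftrightarrow> cand c l a"
  by (auto simp: cand_def)

text \<open>Candidates read only rows of smaller code, so storing the result in a cell cannot change
  the values it was computed from.\<close>

lemma cval_cong:
  assumes "cand c l a" "i + S c \<le> n" "\<And>y. y < c * (n + 1) \<Longrightarrow> D' y = D y"
  shows "cval D' c i l a = cval D c i l a"
proof -
  \<comment> \<open>Columns are at most \<open>n\<close>, so a smaller code means a smaller cell
    number.\<close>
  have idx: "x * (n + 1) + j < c * (n + 1)" if "x < c" "j \<le> n" for x j
  proof -
    have "x * (n + 1) + j < (x + 1) * (n + 1)" using that by simp
    also have "\<dots> \<le> c * (n + 1)" using that by (intro mult_right_mono) auto
    finally show ?thesis .
  qed
  have "a + B l \<le> c" "i + S a + 1 \<le> n" using assms(1,2) by (auto simp: cand_def)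
  moreover from this have "a < c" "c - (a + B l) < c" using B_pos[of l] by linarith+
  ultimately have "i \<le> n" and *: "a < c" "c - (a + B l) < c" "i + S a + 1 \<le> n" by simp_all
  then show ?thesis
    using assms(3)[OF idx, of a i] assms(3)[OF idx, of "c - (a + B l)" "i + S a + 1"] assms(2)
    by (simp add: cval_def)
qed

lemma best_cong:
  assumes "best X D c i l a v" "i + S c \<le> n" "\<And>y. y < c * (n + 1) \<Longrightarrow> D' y = D y"
  shows "best X D' c i l a v"
  using assms(1) cval_cong[OF _ assms(2,3)] by (auto simp: best_def split: if_splits)

lemma best_skip: "best X D c i l a v \<Longrightarrow> \<not> cand c l' a' \<Longrightarrow> best (insert (l', a') X) D c i l a v"
  by (auto simp: best_def split: if_splits)

lemma best_keep:
  "best X D c i l a v \<Longrightarrow> l \<noteq> 0 \<Longrightarrow> v \<le> cval D c i l' a' \<Longrightarrow> best (insert (l', a') X) D c i l a v"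
  by (auto simp: best_def split: if_splits)

lemma best_take:
  "best X D c i l a v \<Longrightarrow> l = 0 \<or> cval D c i l' a' \<le> v \<Longrightarrow> cand c l' a' \<Longrightarrow> l' \<noteq> 0 \<Longrightarrow>
   best (insert (l', a') X) D c i l' a' (cval D c i l' a')"
  by (force simp: best_def split: if_splits)

definition choices :: "nat \<Rightarrow> (nat \<times> nat) set" where
  "choices x = (\<lambda>x. (Suc (x div N), x mod N)) ` {..<x}"

lemma choices_0 [simp]: "choices 0 = {}"
  and choices_Suc: "choices (Suc x) = insert (Suc (x div N), x mod N) (choices x)"
  by (simp_all add: choices_def lessThan_Suc)

lemma choices_full: "choices (h * N) = {1..h} \<times> {..<N}"
proof -
  have "(l, a) \<in> choices (h * N)" if la: "1 \<le> l" "l \<le> h" "a < N" for l a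
  proof -
    obtain k where k: "l = Suc k" using la(1) by (cases l) auto
    have "k * N + a < Suc k * N" using that(3) by simp
    also have "\<dots> \<le> h * N" using that(2) k by (intro mult_right_mono) auto
    finally have "k * N + a < h * N" .
    moreover have "(l, a) = (\<lambda>x. (Suc (x div N), x mod N)) (k * N + a)" using that(3) k by simp
    ultimately show ?thesis unfolding choices_def by (intro image_eqI) auto
  qed
  moreover have "x div N < h" if "x < h * N" for x using that by (simp add: less_mult_imp_div_less)
  ultimately show ?thesis by (auto simp: choices_def Suc_le_eq)
qed

text \<open>
  Cells with \<open>i + S c > n\<close> are filled with meaningless values, but no cell with \<open>i + S c \<le> n\<close> depends on them.
\<close>

definition dp_done :: "nat \<Rightarrow> ram_state \<Rightarrow> bool" where
  "dp_done y s \<longleftrightarrow> (\<forall>c i. c * (n + 1) + i < y \<longrightarrow> i + S c \<le> n \<longrightarrow>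
     dp_ok (\<lambda>y. rmem s (dp_addr y)) (\<lambda>y. nmem s (adr 4 y)) (\<lambda>y. nmem s (adr 5 y)) c i)"

definition bounds :: "ram_state \<Rightarrow> bool" where
  "bounds s \<longleftrightarrow> nreg s 16 = N * (n + 1) \<and> nreg s 17 = h * N"

definition cell_inv :: "nat \<Rightarrow> ram_state \<Rightarrow> bool" where
  "cell_inv y s \<longleftrightarrow> static s \<and> bounds s \<and> nreg s 21 = y \<and> dp_done y s"

definition cell_regs :: "nat \<Rightarrow> nat \<Rightarrow> nat \<Rightarrow> ram_state \<Rightarrow> bool" where
  "cell_regs x c i s \<longleftrightarrow> static s \<and> bounds s \<and> nreg s 21 = c * (n + 1) + i \<and> c < N \<and> i \<le> n \<and>
     nreg s 22 = c \<and> nreg s 23 = i \<and> nreg s 24 = S c \<and> nreg s 28 = x \<and>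
     dp_done (c * (n + 1) + i) s \<and>
     (i + S c \<le> n \<longrightarrow> rreg s 3 = q i \<and> rreg s 4 = q (i + S c) \<and> rreg s 5 = PS (i + S c) - PS i + q i)"

definition best_so_far :: "(nat \<times> nat) set \<Rightarrow> nat \<Rightarrow> nat \<Rightarrow> ram_state \<Rightarrow> bool" where
  "best_so_far X c i s \<longleftrightarrow> (i + S c \<le> n \<longrightarrow>
     best X (\<lambda>y. rmem s (dp_addr y)) c i (nreg s 26) (nreg s 27) (rreg s 7))"

definition cand_inv :: "nat \<Rightarrow> nat \<Rightarrow> nat \<Rightarrow> ram_state \<Rightarrow> bool" where
  "cand_inv c i x s \<longleftrightarrow> cell_regs x c i s \<and> best_so_far (choices x) c i s"

definition cand_regs :: "nat \<Rightarrow> nat \<Rightarrow> nat \<Rightarrow> ram_state \<Rightarrow> bool" where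
  "cand_regs c l a s \<longleftrightarrow> 1 \<le> l \<and> l \<le> h \<and> nreg s 29 = l \<and>
     nreg s 30 = a \<and> nreg s 34 = c - (a + B l) \<and> nreg s 35 = S a"

lemma runs_cand_head:
  assumes "x < h * N" "cand_inv c i x s"
  defines "l \<equiv> Suc (x div N)" and "a \<equiv> x mod N"
  shows "runs (Blk cand_head) s 26 (\<lambda>s. cand_inv c i x s \<and> cand_regs c l a s \<and>
    (nreg s 38 = 0 \<longleftrightarrow> cand c l a))"
proof (rule runs_BlkI)
  fix s' assume s': "s' = fold effect cand_head s"
  have l: "1 \<le> l" "l \<le> h" using assms(1) by (auto simp: l_def Suc_le_eq less_mult_imp_div_less)
  have a: "a < N" by (simp add: a_def)
  have xa: "x - x div N * N = a" by (simp add: a_def minus_div_mult_eq_mod)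
  have xl: "Suc (x div N) = l" by (simp add: l_def)
  have s: "static s" "c < N" using assms(2) by (auto simp: cand_inv_def cell_regs_def)
  then have mem: "nmem s (Suc l) = m l" "nmem s (adr 0 l) = B l" "nmem s (adr 3 a) = S a"
    "nmem s (adr 3 (c - (a + B l))) = S (c - (a + B l))"
    using l a by (auto simp: static_def inp_m tabB_D tabS_D)
  have r: "nreg s 28 = x" "nreg s 22 = c" "nreg s 24 = S c" "nreg s 15 = N" "nreg s 2 = 0" "nreg s 3 = 1"
    "nreg s 4 = 8" "nreg s 8 = tg 0" "nreg s 10 = tg 3"
    using assms(2) s by (auto simp: cand_inv_def cell_regs_def static_def regs_def)
  have ev: "rreg s' = rreg s" "nmem s' = nmem s" "rmem s' = rmem s"
    "nreg s' 29 = l" "nreg s' 30 = a" "nreg s' 34 = c - (a + B l)" "nreg s' 35 = S a"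
    "nreg s' 38 = S a + S (c - (a + B l)) + 1 - S c + (S c - (S a + S (c - (a + B l)) + 1))
       + (a + B l - c) + (1 - m l)"
    "regs (nreg s') = regs (nreg s)"
    "\<And>x. x \<in> {15, 16, 17, 21, 22, 23, 24, 26, 27, 28} \<Longrightarrow> nreg s' x = nreg s x"
    unfolding s' cand_head_def by (auto simp: r xa xl mem)
  have "nreg s' 38 = 0 \<longleftrightarrow> cand c l a" unfolding ev(8) by (rule cand_iff)
  then show "cand_inv c i x s' \<and> cand_regs c l a s' \<and> (nreg s' 38 = 0 \<longleftrightarrow> cand c l a)"
    using assms(2) l ev unfolding cand_inv_def cell_regs_def cand_regs_def static_def bounds_def
      dp_done_def best_so_far_def by simp
qed (auto simp: cand_head_def)

text \<open>The frame of a candidate evaluation: the listed natural registers and all real registers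
  other than 3, 4, 5 and 7 are scratch.\<close>

definition same :: "ram_state \<Rightarrow> ram_state \<Rightarrow> bool" where
  "same s s' \<longleftrightarrow> nmem s' = nmem s \<and> rmem s' = rmem s \<and>
     (\<forall>x. x \<notin> {20, 31, 32, 33, 36, 37, 38, 39} \<longrightarrow> nreg s' x = nreg s x) \<and>
     (\<forall>x\<in>{3, 4, 5, 7}. rreg s' x = rreg s x)"

lemma same_cand_inv: "same s s' \<Longrightarrow> cand_inv c i x s \<Longrightarrow> cand_inv c i x s'"
  by (simp add: same_def cand_inv_def cell_regs_def static_def bounds_def dp_done_def
      best_so_far_def regs_def)

lemma runs_cand_eval:
  assumes inv: "cand_inv c i x s" and cr: "cand_regs c l a s" and cand: "cand c l a"
    and la: "(l, a) = (Suc (x div N), x mod N)"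
  shows "runs cand_eval s 33 (\<lambda>s. cell_regs x c i s \<and> best_so_far (choices (Suc x)) c i s)"
proof -
  define D where "D = (\<lambda>y. rmem s (dp_addr y))"
  have s: "static s" using inv by (auto simp: cand_inv_def cell_regs_def)
  have l: "1 \<le> l" "l \<le> h" using cr by (auto simp: cand_regs_def)
  have C: "nmem s (Suc (h + l)) = C l" using s l by (simp add: static_def inp_C)
  have r: "nreg s 2 = 0" "nreg s 3 = 1" "nreg s 6 = h" "nreg s 7 = n + 1" "nreg s 8 = tg 0"
    "nreg s 23 = i" "nreg s 29 = l" "nreg s 30 = a" "nreg s 34 = c - (a + B l)" "nreg s 35 = S a"
    using inv cr by (auto simp: cand_inv_def cell_regs_def cand_regs_def static_def regs_def)
  \<comment> \<open>\<open>M1\<close> to \<open>M4\<close> hold after the successive components: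
    access cost and weight, left leaf, right leaf, the two subtrees. All refer to the initial
    \<open>s\<close>, which fixes the cost table \<open>D\<close>.\<close>
  define M1 where "M1 s' \<longleftrightarrow> same s s' \<and> rreg s' 8 = real (C l) \<and> rreg s' 9 = rreg s 5" for s'
  define M2 where "M2 s' \<longleftrightarrow> same s s' \<and> rreg s' 8 = real (C l) \<and>
      rreg s' 9 = rreg s 5 + (if a = 0 then rreg s 3 else 0)" for s'
  define M3 where "M3 s' \<longleftrightarrow> same s s' \<and> rreg s' 8 = real (C l) \<and>
      rreg s' 9 = rreg s 5 + (if a = 0 then rreg s 3 else 0) + (if c - (a + B l) = 0 then rreg s 4 else 0)" for s'
  define M4 where "M4 s' \<longleftrightarrow> same s s' \<and> (i + S c \<le> n \<longrightarrow> rreg s' 8 = cval D c i l a)" for s'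
  have 1: "runs (Blk cand_root) s 6 M1"
    by (rule runs_Blk) (simp_all add: cand_root_def M1_def same_def r C)
  have 2: "runs (If 30 2 (Blk [RArith Plus 9 9 3]) (Blk [])) s' 3 M2" if "M1 s'" for s'
  proof (rule runs_If)
    show "runs (Blk [RArith Plus 9 9 3]) s' 1 M2" if "nreg s' 30 \<le> nreg s' 2"
      using \<open>M1 s'\<close> that by (intro runs_Blk) (simp_all add: M1_def M2_def same_def r)
    show "runs (Blk []) s' 1 M2" if "\<not> nreg s' 30 \<le> nreg s' 2"
      using \<open>M1 s'\<close> that by (intro runs_Blk) (simp_all add: M1_def M2_def same_def r)
  qed simp
  have 3: "runs (If 34 2 (Blk [RArith Plus 9 9 4]) (Blk [])) s' 3 M3" if "M2 s'" for s'
  proof (rule runs_If)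
    show "runs (Blk [RArith Plus 9 9 4]) s' 1 M3" if "nreg s' 34 \<le> nreg s' 2"
      using \<open>M2 s'\<close> that by (intro runs_Blk) (simp_all add: M2_def M3_def same_def r)
    show "runs (Blk []) s' 1 M3" if "\<not> nreg s' 34 \<le> nreg s' 2"
      using \<open>M2 s'\<close> that by (intro runs_Blk) (simp_all add: M2_def M3_def same_def r)
  qed simp
  have vals: "rreg s 3 = q i" "rreg s 4 = q (i + S c)" "rreg s 5 = PS (i + S c) - PS i + q i"
    if "i + S c \<le> n" using inv that by (auto simp: cand_inv_def cell_regs_def)
  have 4: "runs (Blk cand_children) s' 13 M4" if "M3 s'" for s'
  proof (rule runs_BlkI)
    fix s'' assume s'': "s'' = fold effect cand_children s'"
    have *: "rreg s'' 8 = rreg s' 8 * rreg s' 9 + rmem s' (nreg s' 8 + (nreg s' 30 * nreg s' 7 + nreg s' 23))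
        + rmem s' (nreg s' 8 + (nreg s' 34 * nreg s' 7 + (nreg s' 23 + nreg s' 35 + nreg s' 3)))"
      "same s' s''"
      by (simp_all add: s'' cand_children_def same_def)
    have sm: "same s s'" and r9: "rreg s' 8 = real (C l)" "rreg s' 9 = rreg s 5 +
        (if a = 0 then rreg s 3 else 0) + (if c - (a + B l) = 0 then rreg s 4 else 0)"
      using that by (auto simp: M3_def)
    have r': "nreg s' 30 = a" "nreg s' 7 = n + 1" "nreg s' 23 = i" "nreg s' 8 = tg 0" "nreg s' 3 = 1"
      "nreg s' 34 = c - (a + B l)" "nreg s' 35 = S a" "rmem s' = rmem s"
      using sm r by (simp_all add: same_def)
    have "same s s''" using sm *(2) by (simp add: same_def)
    then show "M4 s''"
      unfolding M4_def *(1) r' dp_addr_fold r9 cval_def D_def using vals by auto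
  qed (auto simp: cand_children_def)
  have pre: "cell_regs x c i s' \<and> best_so_far (choices x) c i s'" if "M4 s'" for s'
    using same_cand_inv[OF _ inv] that by (simp add: M4_def cand_inv_def)
  \<comment> \<open>Level 0 marks an empty record; its value 0 is only a placeholder, so the first
    candidate is taken without a comparison.\<close>
  have take: "runs (Blk take_cand) s' 4 (\<lambda>s. cell_regs x c i s \<and> best_so_far (choices (Suc x)) c i s)"
    if M4: "M4 s'" and le: "nreg s' 26 = 0 \<or> rreg s' 8 \<le> rreg s' 7" for s'
  proof (rule runs_BlkI)
    fix s'' assume s'': "s'' = fold effect take_cand s'"
    have sm: "nmem s' = nmem s" "rmem s' = rmem s" "nreg s' 29 = l" "nreg s' 30 = a" "nreg s' 2 = 0"
      using M4 r by (simp_all add: M4_def same_def)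
    have ev: "nmem s'' = nmem s'" "rmem s'' = rmem s" "nreg s'' 26 = l" "nreg s'' 27 = a"
      "rreg s'' 7 = rreg s' 8" "\<And>x. x \<noteq> 26 \<Longrightarrow> x \<noteq> 27 \<Longrightarrow> nreg s'' x = nreg s' x"
      "\<And>x. x \<noteq> 7 \<Longrightarrow> x \<noteq> 10 \<Longrightarrow> rreg s'' x = rreg s' x"
      by (simp_all add: s'' take_cand_def sm)
    have "cell_regs x c i s''"
      using pre[OF M4] ev sm by (simp add: cell_regs_def static_def bounds_def dp_done_def regs_def)
    moreover have "best_so_far (choices (Suc x)) c i s''"
      unfolding best_so_far_def
    proof
      assume v: "i + S c \<le> n"
      then have "rreg s' 8 = cval D c i l a" using M4 by (simp add: M4_def)
      moreover have "best (choices x) D c i (nreg s' 26) (nreg s' 27) (rreg s' 7)"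
        using pre[OF M4] v sm by (simp add: best_so_far_def D_def)
      ultimately have "best (insert (l, a) (choices x)) D c i l a (rreg s' 8)"
        using best_take[OF _ _ cand] le l by simp
      then show "best (choices (Suc x)) (\<lambda>y. rmem s'' (dp_addr y)) c i (nreg s'' 26) (nreg s'' 27) (rreg s'' 7)"
        unfolding choices_Suc la[symmetric] ev D_def .
    qed
    ultimately show "cell_regs x c i s'' \<and> best_so_far (choices (Suc x)) c i s''" ..
  qed (auto simp: take_cand_def)
  have keep: "runs (Blk []) s' 4 (\<lambda>s. cell_regs x c i s \<and> best_so_far (choices (Suc x)) c i s)"
    if M4: "M4 s'" and "nreg s' 26 \<noteq> 0" "rreg s' 7 \<le> rreg s' 8" for s'
  proof (rule runs_Blk)
    have "best_so_far (choices (Suc x)) c i s'"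
      unfolding best_so_far_def
    proof
      assume v: "i + S c \<le> n"
      then have "rreg s' 8 = cval D c i l a" "rmem s' = rmem s" using M4 by (simp_all add: M4_def same_def)
      moreover have "best (choices x) (\<lambda>y. rmem s' (dp_addr y)) c i (nreg s' 26) (nreg s' 27) (rreg s' 7)"
        using pre[OF M4] v by (simp add: best_so_far_def)
      ultimately show "best (choices (Suc x)) (\<lambda>y. rmem s' (dp_addr y)) c i (nreg s' 26) (nreg s' 27) (rreg s' 7)"
        unfolding choices_Suc la[symmetric] using that(2,3) by (intro best_keep) (auto simp: D_def)
    qed
    then show "cell_regs x c i (fold effect [] s') \<and> best_so_far (choices (Suc x)) c i (fold effect [] s')"
      using pre[OF M4] by simp
  qed auto
  have 5: "runs (If 26 2 (Blk take_cand) (IfR 7 8 (Blk []) (Blk take_cand))) s' 8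
      (\<lambda>s. cell_regs x c i s \<and> best_so_far (choices (Suc x)) c i s)" if M4: "M4 s'" for s'
  proof (rule runs_If[where t = 6])
    have r2: "nreg s' 2 = 0" using M4 r by (simp add: M4_def same_def)
    show "runs (Blk take_cand) s' 6 (\<lambda>s. cell_regs x c i s \<and> best_so_far (choices (Suc x)) c i s)"
      if "nreg s' 26 \<le> nreg s' 2"
      by (rule runs_conseq[OF take[OF M4]]) (use that r2 in auto)
    show "runs (IfR 7 8 (Blk []) (Blk take_cand)) s' 6
        (\<lambda>s. cell_regs x c i s \<and> best_so_far (choices (Suc x)) c i s)"
      if "\<not> nreg s' 26 \<le> nreg s' 2"
      by (rule runs_IfR[where t = 4]) (use that r2 keep[OF M4] take[OF M4] in auto)
  qed simp
  show ?thesis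
    unfolding cand_eval_def
    by (rule runs_SeqI[OF 1 runs_SeqI[OF 2 runs_SeqI[OF 3 runs_SeqI[OF 4 5]]]]; assumption?) (rule order_refl | simp)+
qed

lemma runs_cand_body:
  assumes "x < h * N" "cand_inv c i x s"
  shows "runs cand_body s 62 (cand_inv c i (Suc x))"
  unfolding cand_body_def
proof (rule runs_SeqI[OF runs_cand_head[OF assms]])
  let ?l = "Suc (x div N)" and ?a = "x mod N"
  let ?Q = "\<lambda>s. cell_regs x c i s \<and> best_so_far (choices (Suc x)) c i s"
  fix s assume s: "cand_inv c i x s \<and> cand_regs c ?l ?a s \<and> (nreg s 38 = 0 \<longleftrightarrow> cand c ?l ?a)"
  then have r2: "nreg s 2 = 0" by (auto simp: cand_inv_def cell_regs_def static_def regs_def)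
  show "runs (If 38 2 cand_eval (Blk []) ;; Blk [NArith Plus 28 28 3]) s 36 (cand_inv c i (Suc x))"
  proof (rule runs_SeqI[where M = ?Q])
    show "runs (If 38 2 cand_eval (Blk [])) s 35 ?Q"
    proof (rule runs_If[where t = 33])
      show "runs cand_eval s 33 ?Q" if "nreg s 38 \<le> nreg s 2"
        using s that r2 by (intro runs_cand_eval) auto
      show "runs (Blk []) s 33 ?Q" if "\<not> nreg s 38 \<le> nreg s 2"
        using s that r2 by (intro runs_Blk) (auto simp: cand_inv_def best_so_far_def choices_Suc best_skip)
    qed simp
    show "runs (Blk [NArith Plus 28 28 3]) s 1 (cand_inv c i (Suc x))" if "?Q s" for s
      using that by (intro runs_Blk)
        (simp_all add: cand_inv_def cell_regs_def static_def bounds_def best_so_far_def dp_done_def regs_def)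
  qed simp
qed simp

lemma runs_cell_head:
  assumes "y < N * (n + 1)" "cell_inv y s"
  defines "c \<equiv> y div (n + 1)" and "i \<equiv> y mod (n + 1)"
  shows "runs (Blk cell_head) s 21 (cand_inv c i 0)"
proof (rule runs_BlkI)
  fix s' assume s': "s' = fold effect cell_head s"
  have y: "y = c * (n + 1) + i" "c < N" "i \<le> n" "y div Suc n = c" "y - y div Suc n * Suc n = i"
    using assms(1) by (auto simp: c_def i_def less_mult_imp_div_less minus_div_mult_eq_mod
        simp del: mult_Suc mult_Suc_right simp flip: less_Suc_eq_le)
  have s: "static s" "nreg s 21 = y" using assms(2) by (auto simp: cell_inv_def)
  then have mem: "nmem s (adr 3 c) = S c" using tabS_D[of N "nmem s" c] y(2) by (simp add: static_def)
  have rm: "rmem s (Suc (n + i)) = q i" "rmem s (Suc (n + (i + S c))) = q (i + S c)"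
    "rmem s (Suc (Suc (2 * n + i))) = PS i" "rmem s (Suc (Suc (2 * n + (i + S c)))) = PS (i + S c)"
    if "i + S c \<le> n"
    using s(1) that by (auto simp: static_def rinp_q tabP_D)
  have r: "nreg s 2 = 0" "nreg s 3 = 1" "nreg s 4 = 8" "nreg s 7 = Suc n" "nreg s 10 = tg 3" "nreg s 18 = 2 * n + 2"
    using s by (auto simp: static_def regs_def)
  have ev: "nmem s' = nmem s" "rmem s' = rmem s" "nreg s' 22 = c" "nreg s' 23 = i" "nreg s' 24 = S c"
    "nreg s' 26 = 0" "nreg s' 27 = 0" "nreg s' 28 = 0" "rreg s' 7 = 0"
    "\<And>x. x \<in> {15, 16, 17, 21} \<Longrightarrow> nreg s' x = nreg s x" "regs (nreg s') = regs (nreg s)"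
    "rreg s' 3 = rmem s (Suc (n + i))" "rreg s' 4 = rmem s (Suc (n + (i + S c)))"
    "rreg s' 5 = rmem s (Suc (Suc (2 * n + (i + S c)))) - rmem s (Suc (Suc (2 * n + i))) + rmem s (Suc (n + i))"
    unfolding s' cell_head_def by (auto simp: r s(2) y(5) y(4) mem y(5)[unfolded y(4)] simp del: mult_Suc_right)
  have "cell_regs 0 c i s'"
    using assms(2) y(1-3) rm ev by (simp add: cell_inv_def cell_regs_def static_def bounds_def dp_done_def)
  moreover have "best_so_far (choices 0) c i s'"
    using ev by (simp add: best_so_far_def best_def)
  ultimately show "cand_inv c i 0 s'" by (simp add: cand_inv_def)
qed (auto simp: cell_head_def)

lemma dp_ok_cong:
  assumes "dp_ok D L A c i" "i + S c \<le> n"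
    and "\<And>y. y \<le> c * (n + 1) + i \<Longrightarrow> D' y = D y \<and> L' y = L y \<and> A' y = A y"
  shows "dp_ok D' L' A' c i"
  using best_cong[OF assms(1)[unfolded dp_ok_def] assms(2), of D'] assms(3) by (simp add: dp_ok_def)

lemma runs_cell_tail:
  assumes "cand_inv c i (h * N) s"
  shows "runs (Blk cell_tail) s 9 (cell_inv (Suc (c * (n + 1) + i)))"
proof (rule runs_BlkI)
  fix s' assume s': "s' = fold effect cell_tail s"
  define y where "y = c * (n + 1) + i"
  have inv: "cell_regs (h * N) c i s" "best_so_far (choices (h * N)) c i s"
    using assms by (auto simp: cand_inv_def)
  then have st: "static s" "bounds s" "nreg s 21 = y" "dp_done y s" "i \<le> n"
    by (auto simp: cell_regs_def y_def)
  then have r: "nreg s 3 = 1" "nreg s 4 = 8" "nreg s 8 = tg 0" "nreg s 11 = tg 4" "nreg s 12 = tg 5"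
    by (auto simp: static_def regs_def)
  have ev: "rmem s' = (rmem s)(dp_addr y := rreg s 7)"
    "nmem s' = (nmem s)(adr 4 y := nreg s 26, adr 5 y := nreg s 27)"
    "nreg s' 21 = Suc y" "\<And>x. x \<noteq> 20 \<Longrightarrow> x \<noteq> 21 \<Longrightarrow> nreg s' x = nreg s x"
    unfolding s' cell_tail_def by (auto simp: r st)
  have "static s'" "bounds s'"
    using st ev(3,4) unfolding static_def bounds_def ev(1,2) by (simp_all add: regs_def)
  moreover have "dp_done (Suc y) s'"
    unfolding dp_done_def
  proof (intro allI impI)
    fix c' i' assume less: "c' * (n + 1) + i' < Suc y" and v: "i' + S c' \<le> n"
    show "dp_ok (\<lambda>y. rmem s' (dp_addr y)) (\<lambda>y. nmem s' (adr 4 y)) (\<lambda>y. nmem s' (adr 5 y)) c' i'"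
    proof (cases "c' * (n + 1) + i' = y")
      case False
      then have "c' * (n + 1) + i' < y" using less by simp
      then show ?thesis
        by (intro dp_ok_cong[OF st(4)[unfolded dp_done_def, rule_format] v]) (use v in \<open>auto simp: ev\<close>)
    next
      case True
      \<comment> \<open>Both starts are at most \<open>n\<close>, so the cell number determines code
        and start.\<close>
      have "(c' * (n + 1) + i') div (n + 1) = c'" "(c' * (n + 1) + i') mod (n + 1) = i'"
        "(c * (n + 1) + i) div (n + 1) = c" "(c * (n + 1) + i) mod (n + 1) = i"
        using v st(5) by (simp_all only: div_mult_self3 mod_mult_self3 mod_less div_less)
      then have "c' = c" "i' = i" using True unfolding y_def by metis+
      moreover have "best ({1..h} \<times> {..<N}) (\<lambda>y. rmem s' (dp_addr y)) c i (nreg s 26) (nreg s 27) (rreg s 7)"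
        by (rule best_cong[of _ "\<lambda>y. rmem s (dp_addr y)"])
          (use inv(2) v \<open>c' = c\<close> \<open>i' = i\<close> in \<open>auto simp: best_so_far_def choices_full ev y_def\<close>)
      ultimately show ?thesis
        unfolding dp_ok_def True by (simp add: ev)
    qed
  qed
  ultimately show "cell_inv (Suc (c * (n + 1) + i)) s'"
    using ev(3) by (simp add: cell_inv_def y_def)
qed (auto simp: cell_tail_def)

lemma runs_cell_body:
  assumes "y < N * (n + 1)" "cell_inv y s"
  shows "runs cell_body s (h * N * 64 + 31) (cell_inv (Suc y))"
  unfolding cell_body_def
proof (rule runs_SeqI[OF runs_cell_head[OF assms]])
  let ?c = "y div (n + 1)" and ?i = "y mod (n + 1)"
  fix s assume s: "cand_inv ?c ?i 0 s"
  have y: "?c * (n + 1) + ?i = y" by (rule div_mult_mod_eq)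
  show "runs (While 28 17 cand_body ;; Blk cell_tail) s (h * N * 64 + 10) (cell_inv (Suc y))"
  proof (rule runs_SeqI[where M = "cand_inv ?c ?i (h * N)"])
    show "runs (While 28 17 cand_body) s (h * N * 64 + 1) (cand_inv ?c ?i (h * N))"
      by (rule runs_for[where Inv = "cand_inv ?c ?i" and lo = 0, OF runs_cand_body])
        (use s in \<open>auto simp: cand_inv_def cell_regs_def bounds_def\<close>)
    show "runs (Blk cell_tail) s' 9 (cell_inv (Suc y))" if "cand_inv ?c ?i (h * N) s'" for s'
      using runs_cell_tail[OF that] unfolding y .
  qed simp
qed simp

lemma runs_solve:
  assumes "static s"
  shows "runs solve s (3 + (N * (n + 1) * (h * N * 64 + 33) + 1))
    (\<lambda>s. static s \<and> dp_done (N * (n + 1)) s)"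
  unfolding solve_def
proof (rule runs_SeqI[where M = "cell_inv 0"])
  show "runs (Blk [NArith Times 16 15 7, NArith Times 17 6 15, NConst 21 0]) s 3 (cell_inv 0)"
    using assms by (intro runs_Blk) (simp_all add: cell_inv_def static_def bounds_def dp_done_def regs_def)
  show "runs (While 21 16 cell_body) s' (N * (n + 1) * (h * N * 64 + 33) + 1)
      (\<lambda>s. static s \<and> dp_done (N * (n + 1)) s)" if "cell_inv 0 s'" for s'
    by (rule runs_for[where Inv = cell_inv and lo = 0, OF runs_cell_body])
      (use that in \<open>auto simp: cell_inv_def bounds_def\<close>)
qed simp

end

section \<open>Writing the solution\<close>

definition pop :: "instr list" where
  "pop = [NArith Minus 21 21 3] @ ld 22 21 13 @ ld 23 21 14 @ ld 24 22 11"

text \<open>A stack entry is a subproblem together with the cell that is to receive its root. After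
  the root \<open>k\<close> has been stored there, the cells \<open>3 * k\<close> and
  \<open>3 * k + 1\<close> become the targets of its children; the right child is pushed last and
  expanded first.\<close>

definition expand :: "instr list" where
  "expand = [NArith Divide 25 22 7, NArith Times 20 25 7, NArith Minus 26 22 20] @ ld 27 22 12 @
     ld 28 27 10 @ [NArith Plus 28 28 26, NArith Plus 28 28 3, NStore 23 28] @ ld 29 24 8 @
     [NArith Plus 29 27 29, NArith Minus 30 25 29, NArith Plus 31 28 28, NArith Plus 31 31 28,
      NArith Plus 32 31 3, NArith Plus 33 32 3, NStore 33 24,
      NArith Times 34 27 7, NArith Plus 34 34 26] @ st 21 13 34 @ st 21 14 31 @
     [NArith Plus 21 21 3, NArith Times 34 30 7, NArith Plus 34 34 28] @ st 21 13 34 @ st 21 14 32 @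
     [NArith Plus 21 21 3]"

definition write_body :: com where
  "write_body = Blk pop ;; If 24 2 (Blk [NStore 23 2]) (Blk expand)"

text \<open>The first entry is the whole instance, code \<open>N - 1\<close> and start 0, with
  target cell 0. The loop runs until the stack is empty.\<close>

definition write_tree :: com where
  "write_tree = Blk ([NArith Minus 20 15 3, NArith Times 22 20 7] @ st 2 13 22 @ st 2 14 2 @ [NConst 21 1]) ;;
     While 2 21 write_body"

definition address_body :: "instr list" where
  "address_body = [NArith Plus 22 21 21, NArith Plus 22 22 21, NArith Plus 22 22 3, NArith Plus 22 22 3,
     NLoad 23 22] @ ld 24 23 9 @ [NStore 22 24, NArith Plus 24 24 3] @ st 23 9 24 @ [NArith Plus 21 21 3]"

definition address :: com where
  "address = Blk [NConst 21 1] ;; While 21 7 (Blk address_body)"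

definition parts :: com where
  "parts = prep ;; solve ;; write_tree ;; address"

lemma stores_tree_cong:
  "(\<And>k. k \<in> set (int_labels T) \<Longrightarrow> M' (3 * k) = M (3 * k) \<and> M' (3 * k + 1) = M (3 * k + 1)) \<Longrightarrow>
   stores_tree M' v T = stores_tree M v T"
  by (induction T arbitrary: v) auto

section \<open>Correctness of the traversal that writes the tree\<close>

context hmm begin

lemma tabB_low [simp]: "x < 3 * n + 3 \<Longrightarrow> tabB j (M(x := v)) = tabB j M"
  and tabS_low [simp]: "x < 3 * n + 3 \<Longrightarrow> tabS j (M(x := v)) = tabS j M"
  by (simp_all add: tabB_def tabS_def)

text \<open>The input is no longer mentioned, because the output overwrites its cells. Fixing
  \<open>L\<close> and \<open>A\<close> states that the recorded choices stay unchanged.\<close>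

definition wstatic :: "(nat \<Rightarrow> nat) \<Rightarrow> (nat \<Rightarrow> nat) \<Rightarrow> ram_state \<Rightarrow> bool" where
  "wstatic L A s \<longleftrightarrow> regs (nreg s) \<and> tabB (Suc h) (nmem s) \<and> tabS N (nmem s) \<and>
     (\<forall>y. nmem s (adr 4 y) = L y \<and> nmem s (adr 5 y) = A y)"

definition pending :: "nat \<Rightarrow> nat \<Rightarrow> nat \<Rightarrow> nat \<Rightarrow> ram_state \<Rightarrow> bool" where
  "pending sp c i t s \<longleftrightarrow> nmem s (adr 6 sp) = c * (n + 1) + i \<and> nmem s (adr 7 sp) = t"

lemma runs_pop:
  assumes "wstatic L A s" "nreg s 21 = Suc sp" "nmem s (adr 6 sp) = y" "nmem s (adr 7 sp) = t"
  shows "runs (Blk pop) s 10 (\<lambda>s'. wstatic L A s' \<and> nmem s' = nmem s \<and> nreg s' 21 = sp \<and>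
     nreg s' 22 = y \<and> nreg s' 23 = t \<and> nreg s' 24 = L y)"
proof -
  have r: "nreg s 3 = 1" "nreg s 4 = 8" "nreg s 13 = tg 6" "nreg s 14 = tg 7" "nreg s 11 = tg 4"
    using assms(1) by (auto simp: wstatic_def regs_def)
  show ?thesis
    using assms by (intro runs_Blk) (simp_all add: pop_def wstatic_def r)
qed

lemma runs_expand:
  assumes s: "wstatic L A s" "nreg s 21 = sp" "nreg s 22 = c * (n + 1) + i" "nreg s 23 = t" "t < 3 * n + 3"
    and l: "nreg s 24 = l" "l \<in> {1..h}"
    and c: "c < N" "i + S c \<le> n" "cand c l a" "A (c * (n + 1) + i) = a" "a < N"
    and k: "k = i + S a + 1"
  shows "runs (Blk expand) s 40 (\<lambda>s'. wstatic L A s' \<and> nreg s' 21 = Suc (Suc sp) \<and>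
     pending sp a i (3 * k) s' \<and> pending (Suc sp) (c - (a + B l)) k (3 * k + 1) s' \<and>
     (\<forall>x<sp. nmem s' (adr 6 x) = nmem s (adr 6 x) \<and> nmem s' (adr 7 x) = nmem s (adr 7 x)) \<and>
     (\<forall>x<3 * n + 3. nmem s' x = (if x = 3 * k + 2 then l else if x = t then k else nmem s x)))"
proof (rule runs_BlkI)
  fix s' assume s': "s' = fold effect expand s"
  have r: "nreg s 3 = 1" "nreg s 4 = 8" "nreg s 7 = n + 1" "nreg s 13 = tg 6" "nreg s 14 = tg 7"
    "nreg s 12 = tg 5" "nreg s 10 = tg 3" "nreg s 8 = tg 0"
    using s(1) by (auto simp: wstatic_def regs_def)
  define y where "y = c * (n + 1) + i"
  have y: "y div (n + 1) = c" "y - c * (n + 1) = i"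
    using c(2) unfolding y_def by (simp_all only: div_mult_self3 div_less)
  have mem: "nmem s (adr 5 y) = a" "nmem s (adr 3 a) = S a" "nmem s (adr 0 l) = B l"
    using s(1) c l tabS_D[of N "nmem s" a] tabB_D[of "Suc h" "nmem s" l]
    by (auto simp: wstatic_def y_def)
  have kn: "3 * k + 2 < 3 * n + 3" using c(2,3) k by (simp add: cand_def)
  have k2: "Suc (Suc (k + k + k)) = 3 * k + 2" "Suc (k + k + k) = 3 * k + 1" "k + k + k = 3 * k" by simp_all
  have next_slot: "8 + sp * 8 + tg g = adr g (Suc sp)" for g
    unfolding adr_def by simp
  have ki: "Suc (S a + i) = k" using k by simp
  have ev: "nmem s' = (nmem s)(t := k, 3 * k + 2 := l, adr 6 sp := a * (n + 1) + i, adr 7 sp := 3 * k,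
      adr 6 (Suc sp) := (c - (a + B l)) * (n + 1) + k, adr 7 (Suc sp) := 3 * k + 1)"
    "nreg s' 21 = Suc (Suc sp)" "regs (nreg s') = regs (nreg s)"
    unfolding s' expand_def using s(5) kn
    by (simp_all add: r s(2,4) s(3)[folded y_def] y[simplified] l(1) mem ki k2 next_slot)
  show "wstatic L A s' \<and> nreg s' 21 = Suc (Suc sp) \<and>
     pending sp a i (3 * k) s' \<and> pending (Suc sp) (c - (a + B l)) k (3 * k + 1) s' \<and>
     (\<forall>x<sp. nmem s' (adr 6 x) = nmem s (adr 6 x) \<and> nmem s' (adr 7 x) = nmem s (adr 7 x)) \<and>
     (\<forall>x<3 * n + 3. nmem s' x = (if x = 3 * k + 2 then l else if x = t then k else nmem s x))"
    using s(1,5) kn ev(2,3) unfolding wstatic_def pending_def ev(1) by simp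
qed (auto simp: expand_def)

text \<open>The keys \<open>i + 1\<close> to \<open>i + S c\<close> own the cells
  \<open>3 * i + 3\<close> to \<open>3 * (i + S c) + 2\<close>. Outside these cells and the target,
  the output is preserved, as are the stack entries below \<open>sp\<close>; so pending siblings and
  finished parts are safe.\<close>

definition written :: "nat \<Rightarrow> nat \<Rightarrow> nat \<Rightarrow> nat \<Rightarrow> ram_state \<Rightarrow> ram_state \<Rightarrow> bool" where
  "written sp c i t s s' \<longleftrightarrow>
     (\<forall>x<sp. nmem s' (adr 6 x) = nmem s (adr 6 x) \<and> nmem s' (adr 7 x) = nmem s (adr 7 x)) \<and>
     (\<forall>x<3 * n + 3. x \<noteq> t \<longrightarrow> x \<notin> {3 * i + 3..3 * (i + S c) + 2} \<longrightarrow> nmem s' x = nmem s x)"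

definition subtree_at :: "(nat \<Rightarrow> real) \<Rightarrow> nat \<Rightarrow> nat \<Rightarrow> nat \<Rightarrow> ram_state \<Rightarrow> bst \<Rightarrow> bool" where
  "subtree_at D c i t s T \<longleftrightarrow> realizes T (\<lambda>k. nmem s (3 * k + 2)) c i (D (c * (n + 1) + i)) \<and>
     stores_tree (nmem s) (nmem s t) T"

lemma subtree_at_mono:
  assumes "subtree_at D c i t s T" "nmem s' t = nmem s t"
    and "\<And>x. x \<in> {3 * i + 3..3 * (i + S c) + 2} \<Longrightarrow> nmem s' x = nmem s x"
  shows "subtree_at D c i t s' T"
proof -
  have "realizes T (\<lambda>k. nmem s' (3 * k + 2)) c i (D (c * (n + 1) + i))"
  proof (rule realizes_cong)
    show "realizes T (\<lambda>k. nmem s (3 * k + 2)) c i (D (c * (n + 1) + i))"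
      using assms(1) unfolding subtree_at_def by (rule conjunct1)
    show "nmem s' (3 * k + 2) = nmem s (3 * k + 2)" if "k \<in> {i + 1..i + S c}" for k
      using that by (intro assms(3)) simp
  qed
  moreover have "set (int_labels T) = {i + 1..i + S c}"
    using assms(1) spans_set unfolding subtree_at_def realizes_def by blast
  then have "stores_tree (nmem s') v T = stores_tree (nmem s) v T" for v
    by (intro stores_tree_cong conjI assms(3)) simp_all
  ultimately show ?thesis using assms(1,2) by (simp add: subtree_at_def)
qed

text \<open>Nothing in the loop marks the end of a subproblem, so the claim is in continuation form:
  \<open>u\<close> and \<open>Q\<close> describe the run once the top entry has been worked off. The
  subtree has \<open>S c\<close> keys and \<open>S c + 1\<close> leaves, each handled in one round
  of at most 54 units: 10 to pop, 42 for the branch, 2 for the loop.\<close>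

lemma runs_write_subtree:
  assumes dp: "\<And>c i. c < N \<Longrightarrow> i + S c \<le> n \<Longrightarrow> dp_ok D L A c i"
    and "c < N" "i + S c \<le> n" "wstatic L A s" "nreg s 21 = Suc sp" "pending sp c i t s"
    and "t < 3 * n + 3" "t \<notin> {3 * i + 3..3 * (i + S c) + 2}"
    and "\<And>s' T. wstatic L A s' \<Longrightarrow> nreg s' 21 = sp \<Longrightarrow> written sp c i t s s' \<Longrightarrow>
      subtree_at D c i t s' T \<Longrightarrow> runs (While 2 21 write_body) s' u Q"
  shows "runs (While 2 21 write_body) s (u + 54 * (2 * S c + 1)) Q"
  using assms(2-)
proof (induction c arbitrary: i s sp t u Q rule: less_induct)
  case (less c)
  let ?W = "While 2 21 write_body"
  have st: "wstatic L A s" and sp: "nreg s 21 = Suc sp" and pend: "pending sp c i t s"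
    and t: "t < 3 * n + 3" "t \<notin> {3 * i + 3..3 * (i + S c) + 2}" and cont: "\<And>s' T. wstatic L A s' \<Longrightarrow>
      nreg s' 21 = sp \<Longrightarrow> written sp c i t s s' \<Longrightarrow> subtree_at D c i t s' T \<Longrightarrow> runs ?W s' u Q"
    using less.prems by blast+
  note ok = dp[OF less.prems(1,2)]
  define y where "y = c * (n + 1) + i"
  let ?P = "\<lambda>s'. wstatic L A s' \<and> nmem s' = nmem s \<and> nreg s' 21 = sp \<and>
     nreg s' 22 = y \<and> nreg s' 23 = t \<and> nreg s' 24 = L y"
  have pop: "runs (Blk pop) s 10 ?P"
    using pend by (intro runs_pop[OF st sp]) (simp_all only: pending_def y_def)
  have r2: "nreg s' 2 = 0" if "wstatic L A s'" for s' using that by (simp add: wstatic_def regs_def)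
  have run: "runs ?W s (u + 54 * (2 * S c + 1)) Q"
    if "\<And>s'. ?P s' \<Longrightarrow> runs (If 24 2 (Blk [NStore 23 2]) (Blk expand)) s' 42
      (\<lambda>s'. runs ?W s' (u + 54 * (2 * S c)) Q)"
  proof (rule runs_While_step)
    show "nreg s 2 < nreg s 21" using r2[OF st] sp by simp
    have "runs (Blk pop ;; If 24 2 (Blk [NStore 23 2]) (Blk expand)) s 52
        (\<lambda>s'. runs ?W s' (u + 54 * (2 * S c)) Q)"
      by (rule runs_SeqI[OF pop that]) auto
    then show "runs write_body s 52 (\<lambda>s'. runs ?W s' (u + 54 * (2 * S c)) Q)"
      by (simp only: write_body_def)
  qed simp
  show ?case
  proof (cases "c = 0")
    case True
    then have D: "L y = 0" "D y = 0" using dp_ok_0[of D L A i] ok by (simp_all add: y_def)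
    show ?thesis
    proof (rule run)
      fix s' assume s': "?P s'"
      let ?s = "s'\<lparr>nmem := (nmem s')(t := 0)\<rparr>"
      have "wstatic L A s'" using s' by blast
      then have "wstatic L A ?s" using t(1) by (simp add: wstatic_def)
      moreover have "written sp c i t s ?s" using s' t by (simp add: written_def)
      moreover have "subtree_at D c i t ?s (Ext i)"
        using D(2) realizes_Ext True by (simp add: subtree_at_def y_def)
      ultimately have "runs ?W ?s u Q" using s' by (intro cont[of _ "Ext i"]) simp_all
      then have "runs (Blk [NStore 23 2]) s' 1 (\<lambda>s'. runs ?W s' (u + 54 * (2 * S c)) Q)"
        using s' r2[of s'] True by (intro runs_Blk) simp_all
      then show "runs (If 24 2 (Blk [NStore 23 2]) (Blk expand)) s' 42 (\<lambda>s'. runs ?W s' (u + 54 * (2 * S c)) Q)"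
        using s' D(1) by (intro runs_If[where t = 1]) simp_all
    qed
  next
    case False
    define l a b k where "l = L y" and "a = A y" and "b = c - (a + B l)" and "k = i + S a + 1"
    have l: "l \<in> {1..h}" "a < N" "cand c l a" "D y = cval D c i l a"
      using dp_ok_pos[OF ok] False less.prems(1) unfolding l_def a_def y_def by auto
    have "a + B l \<le> c" and Sc: "S c = S a + S b + 1" using l(3) by (auto simp: cand_def b_def)
    then have ab: "a < c" "b < c" "b < N" using B_pos[of l] less.prems(1) unfolding b_def by linarith+
    have le: "i + S a \<le> n" "k + S b \<le> n" "3 * k + 2 < 3 * n + 3"
      using less.prems(2) Sc by (auto simp: k_def)
    have tk: "t \<notin> {3 * i + 3..3 * (k + S b) + 2}" using t(2) Sc by (simp add: k_def)
    show ?thesis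
    proof (rule run)
      fix s0 assume s0: "?P s0"
      let ?P1 = "\<lambda>s'. wstatic L A s' \<and> nreg s' 21 = Suc (Suc sp) \<and>
        pending sp a i (3 * k) s' \<and> pending (Suc sp) b k (3 * k + 1) s' \<and>
        (\<forall>x<sp. nmem s' (adr 6 x) = nmem s0 (adr 6 x) \<and> nmem s' (adr 7 x) = nmem s0 (adr 7 x)) \<and>
        (\<forall>x<3 * n + 3. nmem s' x = (if x = 3 * k + 2 then l else if x = t then k else nmem s0 x))"
      have expand: "runs (Blk expand) s0 40 ?P1"
        unfolding b_def using s0 t(1) l less.prems(1,2)
        by (intro runs_expand) (simp_all add: y_def l_def a_def k_def)
      have "runs ?W s1 (u + 54 * (2 * S c)) Q" if s1: "?P1 s1" for s1
      proof -
        \<comment> \<open>The right subtree is on top of the stack; its continuation is the left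
          subtree, whose continuation is \<open>cont\<close>. The time splits because
          \<open>2 * S c = (2 * S a + 1) + (2 * S b + 1)\<close>.\<close>
        have "runs ?W s1 (u + 54 * (2 * S a + 1) + 54 * (2 * S b + 1)) Q"
        proof (rule less.IH[OF ab(2) ab(3) le(2)])
          fix s2 T2
          assume s2: "wstatic L A s2" "nreg s2 21 = Suc sp" "written (Suc sp) b k (3 * k + 1) s1 s2"
            "subtree_at D b k (3 * k + 1) s2 T2"
          show "runs ?W s2 (u + 54 * (2 * S a + 1)) Q"
          proof (rule less.IH[OF ab(1) l(2) le(1) s2(1,2)])
            show "pending sp a i (3 * k) s2" using s1 s2(3) by (simp add: pending_def written_def)
            fix s3 T1
            assume s3: "wstatic L A s3" "nreg s3 21 = sp" "written sp a i (3 * k) s2 s3"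
              "subtree_at D a i (3 * k) s3 T1"
            have low3: "nmem s3 x = nmem s2 x"
              if "x < 3 * n + 3" "x \<noteq> 3 * k" "x \<notin> {3 * i + 3..3 * (i + S a) + 2}" for x
              using s3(3) that unfolding written_def by blast
            have low2: "nmem s2 x = nmem s1 x"
              if "x < 3 * n + 3" "x \<noteq> 3 * k + 1" "x \<notin> {3 * k + 3..3 * (k + S b) + 2}" for x
              using s2(3) that unfolding written_def by blast
            have low1: "nmem s1 x = (if x = 3 * k + 2 then l else if x = t then k else nmem s x)"
              if "x < 3 * n + 3" for x
              using s1 s0 that by simp
            \<comment> \<open>The left subtree writes no output cell beyond its target
              \<open>3 * k\<close>, so the finished right subtree survives.\<close>
            have right: "subtree_at D b k (3 * k + 1) s3 T2"
            proof (rule subtree_at_mono[OF s2(4)])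
              show "nmem s3 (3 * k + 1) = nmem s2 (3 * k + 1)"
                using le by (intro low3) (auto simp: k_def)
              show "nmem s3 x = nmem s2 x" if "x \<in> {3 * k + 3..3 * (k + S b) + 2}" for x
                using le that by (intro low3) (auto simp: k_def)
            qed
            have "nmem s3 (3 * k + 2) = nmem s2 (3 * k + 2)" using le by (intro low3) (auto simp: k_def)
            also have "\<dots> = nmem s1 (3 * k + 2)" using le by (intro low2) auto
            also have "\<dots> = l" using low1 le by simp
            finally have lev: "nmem s3 (3 * k + 2) = l" .
            have "nmem s3 t = nmem s2 t" using t tk by (intro low3) (auto simp: k_def)
            also have "\<dots> = nmem s1 t" using t tk by (intro low2) (auto simp: k_def)
            also have "\<dots> = k" using low1 t tk by (auto simp: k_def)
            finally have root: "nmem s3 t = k" .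
            have "realizes (Node T1 k T2) (\<lambda>k. nmem s3 (3 * k + 2)) c i (cval D c i l a)"
              using s3(4) right lev l by (intro realizes_Node) (simp_all add: subtree_at_def b_def k_def)
            then have "subtree_at D c i t s3 (Node T1 k T2)"
              using s3(4) right root l(4) by (simp add: subtree_at_def y_def)
            moreover have "written sp c i t s s3"
              unfolding written_def
            proof (intro conjI allI impI)
              fix x assume "x < sp"
              then show "nmem s3 (adr 6 x) = nmem s (adr 6 x)" "nmem s3 (adr 7 x) = nmem s (adr 7 x)"
                using s3(3) s2(3) s1 s0 by (simp_all add: written_def)
            next
              fix x assume x: "x < 3 * n + 3" "x \<noteq> t" "x \<notin> {3 * i + 3..3 * (i + S c) + 2}"
              have "nmem s3 x = nmem s2 x" using x Sc by (intro low3) (auto simp: k_def)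
              also have "\<dots> = nmem s1 x" using x Sc by (intro low2) (auto simp: k_def)
              also have "\<dots> = nmem s x" using low1[OF x(1)] x Sc by (auto simp: k_def)
              finally show "nmem s3 x = nmem s x" .
            qed
            ultimately show "runs ?W s3 u Q" using s3(1,2) by (intro cont)
          qed (use le in \<open>auto simp: k_def\<close>)
        qed (use s1 le in auto)
        then show ?thesis by (rule runs_conseq) (auto simp: Sc)
      qed
      then have "runs (Blk expand) s0 40 (\<lambda>s'. runs ?W s' (u + 54 * (2 * S c)) Q)"
        by (intro runs_conseq[OF expand order_refl])
      moreover have "\<not> nreg s0 24 \<le> nreg s0 2" using s0 r2[of s0] l(1) by (auto simp: l_def)
      ultimately show "runs (If 24 2 (Blk [NStore 23 2]) (Blk expand)) s0 42 (\<lambda>s'. runs ?W s' (u + 54 * (2 * S c)) Q)"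
        by (intro runs_If[where t = 40]) auto
    qed
  qed
qed

definition tree_written :: "ram_state \<Rightarrow> bst \<Rightarrow> bool" where
  "tree_written s T \<longleftrightarrow> regs (nreg s) \<and> tabB (Suc h) (nmem s) \<and> stores_tree (nmem s) (nmem s 0) T \<and>
     (\<exists>D L A. (\<forall>c i. c < N \<longrightarrow> i + S c \<le> n \<longrightarrow> dp_ok D L A c i) \<and>
       realizes T (\<lambda>k. nmem s (3 * k + 2)) (N - 1) 0 (D ((N - 1) * (n + 1))))"

lemma runs_write_tree:
  assumes s: "static s" "dp_done (N * (n + 1)) s"
  shows "runs write_tree s (9 + (1 + 54 * (2 * n + 1))) (\<lambda>s. \<exists>T. tree_written s T)"
proof -
  define D L A where "D y = rmem s (dp_addr y)" and "L y = nmem s (adr 4 y)" and "A y = nmem s (adr 5 y)" for y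
  have dp: "dp_ok D L A c i" if "c < N" "i + S c \<le> n" for c i
  proof -
    have "c * (n + 1) + i < (c + 1) * (n + 1)" using that by simp
    also have "\<dots> \<le> N * (n + 1)" using that by (intro mult_right_mono) auto
    finally show ?thesis using s(2) that unfolding dp_done_def D_def L_def A_def by blast
  qed
  have r: "nreg s 2 = 0" "nreg s 3 = 1" "nreg s 4 = 8" "nreg s 7 = n + 1" "nreg s 15 = N"
    "nreg s 13 = tg 6" "nreg s 14 = tg 7"
    using s(1) by (auto simp: static_def regs_def)
  have tg: "tg g = adr g 0" for g by (simp only: adr_def mult_0 add_0)
  show ?thesis
    unfolding write_tree_def
  proof (rule runs_SeqI[where M = "\<lambda>s. wstatic L A s \<and> nreg s 21 = Suc 0 \<and> pending 0 (N - 1) 0 0 s"])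
    show "runs (Blk ([NArith Minus 20 15 3, NArith Times 22 20 7] @ st 2 13 22 @ st 2 14 2 @ [NConst 21 1])) s 9
        (\<lambda>s. wstatic L A s \<and> nreg s 21 = Suc 0 \<and> pending 0 (N - 1) 0 0 s)"
      using s(1) by (intro runs_Blk) (simp_all add: wstatic_def pending_def static_def L_def A_def r tg)
    fix s assume s: "wstatic L A s \<and> nreg s 21 = Suc 0 \<and> pending 0 (N - 1) 0 0 s"
    have "runs (While 2 21 write_body) s (1 + 54 * (2 * S (N - 1) + 1)) (\<lambda>s. \<exists>T. tree_written s T)"
    proof (rule runs_write_subtree[OF dp])
      fix s' T assume s': "wstatic L A s'" "nreg s' 21 = 0" "subtree_at D (N - 1) 0 0 s' T"
      have "tree_written s' T"
        using s' dp unfolding tree_written_def wstatic_def subtree_at_def add_0_right by blast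
      then show "runs (While 2 21 write_body) s' 1 (\<lambda>s. \<exists>T. tree_written s T)"
        using s' by (intro runs_While_stop) auto
    qed (use s S_full in auto)
    then show "runs (While 2 21 write_body) s (1 + 54 * (2 * n + 1)) (\<lambda>s. \<exists>T. tree_written s T)"
      unfolding S_full .
  qed simp
qed

section \<open>Replacing levels by addresses\<close>

definition assigned :: "(nat \<Rightarrow> nat) \<Rightarrow> nat \<Rightarrow> nat" where
  "assigned lev k = off (lev k) + card {j \<in> {1..k}. lev j = lev k}"

text \<open>Until it is replaced by the address, cell \<open>3k+2\<close> holds the level of the key \<open>k\<close>.\<close>

definition address_inv :: "(nat \<Rightarrow> nat) \<Rightarrow> (nat \<Rightarrow> nat) \<Rightarrow> nat \<Rightarrow> ram_state \<Rightarrow> bool" where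
  "address_inv M lev k s \<longleftrightarrow> regs (nreg s) \<and> 1 \<le> k \<and> nreg s 21 = k \<and>
     (\<forall>l\<in>{1..h}. nmem s (adr 2 l) = Suc (off l + card {j \<in> {1..<k}. lev j = l})) \<and>
     (\<forall>j\<in>{1..<k}. nmem s (3 * j + 2) = assigned lev j) \<and>
     (\<forall>j\<in>{k..n}. nmem s (3 * j + 2) = lev j) \<and>
     (\<forall>x<3 * n + 3. x mod 3 \<noteq> 2 \<longrightarrow> nmem s x = M x)"

lemma runs_address_body:
  assumes "k < Suc n" "address_inv M lev k s" "\<And>k. k \<in> {1..n} \<Longrightarrow> lev k \<in> {1..h}"
  shows "runs (Blk address_body) s 14 (address_inv M lev (Suc k))"
proof (rule runs_BlkI)
  fix s' assume s': "s' = fold effect address_body s"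
  have k: "1 \<le> k" "k \<le> n" using assms by (auto simp: address_inv_def)
  have lev: "lev k \<in> {1..h}" using assms(3) k by simp
  have r: "nreg s 3 = 1" "nreg s 4 = 8" "nreg s 9 = tg 2" "nreg s 21 = k"
    using assms(2) by (auto simp: address_inv_def regs_def)
  have eq: "{j \<in> {1..<Suc k}. lev j = l} = (if lev k = l then insert k {j \<in> {1..<k}. lev j = l}
      else {j \<in> {1..<k}. lev j = l})" for l
    using k by (auto simp: less_Suc_eq)
  have card: "card {j \<in> {1..<Suc k}. lev j = l} = card {j \<in> {1..<k}. lev j = l} + (if lev k = l then 1 else 0)" for l
    unfolding eq by simp
  have asg: "assigned lev k = Suc (off (lev k) + card {j \<in> {1..<k}. lev j = lev k})"
    using card[of "lev k"] by (simp add: assigned_def atLeastLessThanSuc_atLeastAtMost)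
  have mem: "nmem s (3 * k + 2) = lev k" "nmem s (adr 2 (lev k)) = assigned lev k"
    using assms(2) k lev unfolding asg by (auto simp: address_inv_def)
  have k3: "Suc (Suc (k + k + k)) = 3 * k + 2" by simp
  have k3n: "3 * k + 2 < 3 * n + 3" using k by simp
  have ev: "nmem s' = (nmem s)(3 * k + 2 := assigned lev k, adr 2 (lev k) := Suc (assigned lev k))"
    "nreg s' 21 = Suc k" "regs (nreg s') = regs (nreg s)"
    unfolding s' address_body_def using k3n by (simp_all add: r k3 mem del: add_2_eq_Suc')
  have "nmem s' (adr 2 l) = Suc (off l + card {j \<in> {1..<Suc k}. lev j = l})" if "l \<in> {1..h}" for l
    using that assms(2) k3n unfolding card ev(1) by (auto simp: address_inv_def asg)
  moreover have "nmem s' (3 * j + 2) = assigned lev j" if "j \<in> {1..<Suc k}" for j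
  proof (cases "j = k")
    case False
    then have "nmem s (3 * j + 2) = assigned lev j" "3 * j + 2 < 3 * n + 3"
      using that assms(2) k by (auto simp: address_inv_def)
    then show ?thesis using False unfolding ev(1) by (simp del: add_2_eq_Suc')
  qed (use k3n in \<open>simp add: ev(1) del: add_2_eq_Suc'\<close>)
  moreover have "nmem s' (3 * j + 2) = lev j" if "j \<in> {Suc k..n}" for j
  proof -
    have "nmem s (3 * j + 2) = lev j" "3 * j + 2 < 3 * n + 3"
      using that assms(2) by (auto simp: address_inv_def)
    then show ?thesis using that unfolding ev(1) by (simp del: add_2_eq_Suc')
  qed
  moreover have "nmem s' x = M x" if "x < 3 * n + 3" "x mod 3 \<noteq> 2" for x
  proof -
    have "x \<noteq> 3 * k + 2" using that(2) by presburger
    then show ?thesis using that assms(2) unfolding ev(1) by (simp add: address_inv_def)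
  qed
  moreover have "regs (nreg s')" "1 \<le> Suc k" using assms(2) ev(3) by (simp_all add: address_inv_def)
  ultimately show "address_inv M lev (Suc k) s'"
    using ev(2) unfolding address_inv_def by blast
qed (auto simp: address_body_def)

lemma runs_address:
  assumes "tree_written s T"
  shows "runs address s (1 + (n * 16 + 1)) (\<lambda>s. \<exists>\<phi>. outputs n s T \<phi> \<and> optimum I T \<phi>)"
proof -
  define lev where "lev k = nmem s (3 * k + 2)" for k
  obtain D L A where dp: "\<And>c i. c < N \<Longrightarrow> i + S c \<le> n \<Longrightarrow> dp_ok D L A c i"
    and T: "realizes T lev (N - 1) 0 (D ((N - 1) * (n + 1)))"
    using assms unfolding tree_written_def lev_def by blast
  have opt: "optimum I T (assigned lev)"
    by (rule optimumI[OF dp T]) (auto simp: assigned_def)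
  have lev: "lev k \<in> {1..h}" if "k \<in> {1..n}" for k
    using T that S_full by (simp add: realizes_def)
  have keys: "set (int_labels T) = {1..n}"
    using T S_full spans_set[of T 0 n] by (simp add: realizes_def)
  show ?thesis
    unfolding address_def
  proof (rule runs_SeqI[where M = "address_inv (nmem s) lev 1"])
    show "runs (Blk [NConst 21 1]) s 1 (address_inv (nmem s) lev 1)"
      using assms by (intro runs_Blk) (auto simp: tree_written_def address_inv_def tabB_def lev_def)
    show "runs (While 21 7 (Blk address_body)) s' (n * 16 + 1) (\<lambda>s. \<exists>\<phi>. outputs n s T \<phi> \<and> optimum I T \<phi>)"
      if s': "address_inv (nmem s) lev 1 s'" for s'
    proof (rule runs_for[where Inv = "address_inv (nmem s) lev" and lo = 1])
      show "runs (Blk address_body) s'' 14 (address_inv (nmem s) lev (Suc k))"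
        if "k < Suc n" "address_inv (nmem s) lev k s''" for k s''
        using that lev by (rule runs_address_body)
      show "nreg s'' 21 = k \<and> nreg s'' 7 = Suc n" if "address_inv (nmem s) lev k s''" for k s''
        using that by (simp add: address_inv_def regs_def)
      show "\<exists>\<phi>. outputs n s'' T \<phi> \<and> optimum I T \<phi>" if s'': "address_inv (nmem s) lev (Suc n) s''" for s''
      proof (intro exI conjI)
        have low: "nmem s'' x = nmem s x" if "x < 3 * n + 3" "x mod 3 \<noteq> 2" for x
          using s'' that by (simp add: address_inv_def)
        \<comment> \<open>Child pointers sit at addresses of residue 0 and 1 modulo 3, which the
          last pass leaves alone.\<close>
        have "stores_tree (nmem s'') (nmem s'' 0) T = stores_tree (nmem s) (nmem s'' 0) T"
        proof (rule stores_tree_cong)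
          fix k assume "k \<in> set (int_labels T)"
          then have "k \<le> n" using keys by simp
          moreover have "3 * k mod 3 \<noteq> 2" "(3 * k + 1) mod 3 \<noteq> 2" by presburger+
          ultimately show "nmem s'' (3 * k) = nmem s (3 * k) \<and> nmem s'' (3 * k + 1) = nmem s (3 * k + 1)"
            by (intro conjI low) auto
        qed
        then show "outputs n s'' T (assigned lev)"
          using assms s'' low[of 0] by (simp add: outputs_def tree_written_def address_inv_def)
        show "optimum I T (assigned lev)" by (rule opt)
      qed
    qed (use s' in auto)
  qed simp
qed

section \<open>Total running time\<close>

lemma parts_correct:
  obtains t s T \<phi> where "halts_within (comp 0 parts) t (input_state I) s"
    "t \<le> 450 * (N * N * h * n)" "outputs n s T \<phi>" "optimum I T \<phi>"
proof -
  let ?X = "N * N * h * n"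
  let ?t1 = "19 + (h * (N * 11 + 17) + 1 + (3 + (n * 10 + 1)))"
  let ?t2 = "3 + (N * (n + 1) * (h * N * 64 + 33) + 1)"
  let ?t3 = "9 + (1 + 54 * (2 * n + 1))"
  let ?t4 = "1 + (n * 16 + 1)"
  have run: "runs parts (input_state I) (?t1 + (?t2 + (?t3 + ?t4)))
      (\<lambda>s. \<exists>T \<phi>. outputs n s T \<phi> \<and> optimum I T \<phi>)"
    unfolding parts_def
  proof (rule runs_SeqI[OF prep runs_SeqI[OF runs_solve runs_SeqI[OF runs_write_tree]]])
    fix s assume "\<exists>T. tree_written s T"
    then obtain T where "tree_written s T" by blast
    then show "runs address s ?t4 (\<lambda>s. \<exists>T \<phi>. outputs n s T \<phi> \<and> optimum I T \<phi>)"
      by (rule runs_conseq[OF runs_address]) auto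
  qed auto
  have "pc (input_state I) = 0" by (simp add: input_state_def Let_def)
  then obtain t s where t: "t \<le> ?t1 + (?t2 + (?t3 + ?t4))"
    "halts_within (comp 0 parts) t (input_state I) (s\<lparr>pc := clen parts\<rparr>)"
    and out: "\<exists>T \<phi>. outputs n s T \<phi> \<and> optimum I T \<phi>"
    using runs_halts[OF run] by blast
  have pos: "1 \<le> N" "1 \<le> h" "1 \<le> n" using h_pos n_pos by (auto simp: Suc_le_eq)
  have "1 * 1 * 1 * 1 \<le> ?X" "1 * 1 * 1 * n \<le> ?X" "1 * N * h * 1 \<le> ?X" "1 * 1 * h * 1 \<le> ?X"
    "N * 1 * 1 * n \<le> ?X" "N * N * h * 1 \<le> ?X" "N * 1 * 1 * 1 \<le> ?X"
    using pos by (intro mult_le_mono; simp)+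
  then have b: "1 \<le> ?X" "n \<le> ?X" "N * h \<le> ?X" "h \<le> ?X" "N * n \<le> ?X" "N * N * h \<le> ?X" "N \<le> ?X"
    by simp_all
  \<comment> \<open>Each monomial is at most \<open>?X\<close>, since all of its factors are at
    least 1; the coefficients sum to 450.\<close>
  have "?t1 + (?t2 + (?t3 + ?t4)) = 94 + 11 * (N * h) + 17 * h + 134 * n + 64 * ?X + 64 * (N * N * h)
      + 33 * (N * n) + 33 * N"
    by (simp add: algebra_simps)
  also have "\<dots> \<le> 94 * ?X + 11 * ?X + 17 * ?X + 134 * ?X + 64 * ?X + 64 * ?X + 33 * ?X + 33 * ?X"
    using b by (intro add_mono mult_le_mono2) simp_all
  also have "\<dots> \<le> 450 * ?X" by simp
  finally have "t \<le> 450 * ?X" using t(1) by simp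
  moreover obtain T \<phi> where "outputs n (s\<lparr>pc := clen parts\<rparr>) T \<phi>" "optimum I T \<phi>"
    using out by (auto simp: outputs_def)
  ultimately show thesis using t(2) that by blast
qed

end

theorem mainTheorem1:
  "\<exists>(P :: instr list) (C :: real). \<forall>I. valid_problem I \<longrightarrow>
     (\<exists>t s T \<phi>.
        halts_within P t (input_state I) s \<and>
        real t \<le> C * (2 ^ (nlevels I - 1) / fact (nlevels I - 1)
                      * real (nkeys I) ^ (2 * nlevels I + 1)) \<and>
        outputs (nkeys I) s T \<phi> \<and>
        optimum I T \<phi>)"
proof (intro exI[of _ "comp 0 parts"] exI[of _ "1800 :: real"] allI impI)
  fix I assume "valid_problem I"
  then interpret hmm I by unfold_locales
  obtain t s T \<phi> where *: "halts_within (comp 0 parts) t (input_state I) s"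
    "t \<le> 450 * (N * N * h * n)" "outputs n s T \<phi>" "optimum I T \<phi>"
    using parts_correct .
  have "real t \<le> real (450 * (N * N * h * n))" using *(2) by (simp only: of_nat_le_iff)
  \<comment> \<open>1800 is 450 times the constant 4 of \<open>N_bound\<close>.\<close>
  also have "\<dots> \<le> 1800 * (2 ^ (h - 1) / fact (h - 1) * real n ^ (2 * h + 1))"
    using N_bound by simp
  finally show "\<exists>t s T \<phi>. halts_within (comp 0 parts) t (input_state I) s \<and>
      real t \<le> 1800 * (2 ^ (h - 1) / fact (h - 1) * real n ^ (2 * h + 1)) \<and>
      outputs n s T \<phi> \<and> optimum I T \<phi>"
    using * by blast
qed

end
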